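(* Let $(S,X,T)\sim P_{S,X,T}$ be discrete random variables, and for $r\ge 0$ let $$g^{r}_{0}(P_{S,X,T})=\sup_{P_{Y\mid S,X,T}:\ I(Y;S)=0,\ I(X;Y)\leq r} I(Y;T).$$ Define $$U_0=H(T)+\sum_{t\in\mathcal{T}}\int_{0}^{1} \mathbb{P}_S\{P_{T\mid S}(t\mid S)\geq m\}\,\log\big(\mathbb{P}_S\{P_{T\mid S}(t\mid S)\geq m\}\big)\,dm .$$ (a) For every $0\leq r\leq H(X\mid S)$, $$\max\{L_1^{r},L_2,L_3^{r}\}\leq g^{r}_{0}(P_{S,X,T})\leq \min\{H(T\mid X)+r,\ H(T\mid S),\ U_0\},$$ where, with $\alpha=\frac{r}{H(X\mid S)}$, $L_1^{r} = H(T\mid X,S)+r-H(X,S\mid T)$, $L_2 = H(T\mid X,S)-\big(\log(I(X,S;T)+5.51)+1.06\big)$, $L_3^{r} = H(T\mid X,S)+r-\alpha H(X,S\mid T)-1.06-\log\big((1-\alpha)I(X,S;T)+\alpha\min\{H(T),H(X,S)\}+5.51\big)$. (b) For every $H(X\mid S)\leq r< H(X)$, $$\max\{{L'}_1^{r},L_2\}\leq g^{r}_{0}(P_{S,X,T})\leq \min\{H(T\mid X)+r,\ H(T\mid S),\ U_0\},$$ where ${L'}_1^{r}=H(T\mid S)-H(S\mid T)=H(T)-H(S)$.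
   Context: $S$ (sensitive attribute) takes values in a finite alphabet $\mathcal{S}$; $X$ (useful data) and $T$ (task) take values in finite or countably infinite alphabets $\mathcal{X},\mathcal{T}$, with finite entropies. The supremum is over all conditional distributions $P_{Y\mid S,X,T}$ of a discrete random variable $Y$ (the representation) given $(S,X,T)$. $\mathbb{P}_S$ denotes probability with respect to $S\sim P_S$, and $P_{T\mid S}(t\mid S)$ is the conditional pmf of $T$ evaluated at the random $S$. Logarithms are base 2. *)

theory Defs
  imports "HOL-Analysis.Analysis" "HOL-Probability.Probability_Mass_Function"
begin

definition ent :: "'a pmf \<Rightarrow> real" where
  "ent p = (\<Sum>\<^sub>\<infinity>x. - pmf p x * log 2 (pmf p x))"

definition finite_ent :: "'a pmf \<Rightarrow> bool" where
  "finite_ent p \<longleftrightarrow> (\<lambda>x. - pmf p x * log 2 (pmf p x)) summable_on UNIV"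

definition cond_ent :: "('a \<times> 'b) pmf \<Rightarrow> real" where
  "cond_ent J = ent J - ent (map_pmf snd J)"

definition mut_info :: "('a \<times> 'b) pmf \<Rightarrow> real" where
  "mut_info J = (\<Sum>\<^sub>\<infinity>z. pmf J z *
      log 2 (pmf J z / (pmf (map_pmf fst J) (fst z) * pmf (map_pmf snd J) (snd z))))"

definition joint_Y :: "('s \<times> 'x \<times> 't) pmf \<Rightarrow> ('s \<times> 'x \<times> 't \<Rightarrow> nat pmf) \<Rightarrow> ('s \<times> 'x \<times> 't \<times> nat) pmf" where
  "joint_Y P K = bind_pmf P (\<lambda>w. map_pmf (\<lambda>y. (fst w, fst (snd w), snd (snd w), y)) (K w))"

definition g0 :: "('s \<times> 'x \<times> 't) pmf \<Rightarrow> real \<Rightarrow> real" where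
  "g0 P r = Sup {mut_info (map_pmf (\<lambda>(s,x,t,y). (y,t)) (joint_Y P K)) | K.
       mut_info (map_pmf (\<lambda>(s,x,t,y). (y,s)) (joint_Y P K)) = 0 \<and>
       mut_info (map_pmf (\<lambda>(s,x,t,y). (x,y)) (joint_Y P K)) \<le> r}"

definition condT :: "('s \<times> 'x \<times> 't) pmf \<Rightarrow> 's \<Rightarrow> 't \<Rightarrow> real" where
  "condT P s t = pmf (map_pmf (\<lambda>(s,x,t). (s,t)) P) (s,t) / pmf (map_pmf fst P) s"

definition U0 :: "('s \<times> 'x \<times> 't) pmf \<Rightarrow> real" where
  "U0 P = ent (map_pmf (\<lambda>(s,x,t). t) P) +
     (\<Sum>\<^sub>\<infinity>t. integral {0..1} (\<lambda>m::real.
        measure_pmf.prob (map_pmf fst P) {s. condT P s t \<ge> m} *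
        log 2 (measure_pmf.prob (map_pmf fst P) {s. condT P s t \<ge> m})))"

end

theory Submission
  imports Defs "HOL-Probability.Probability" "HOL-Real_Asymp.Real_Asymp"
begin

text \<open>
  Upper bounds.  The first two are the chain rule and the data processing inequality.  For \<open>U\<^sub>0\<close>, fix \<open>t\<close>: since \<open>Y\<close> is
  independent of \<open>S\<close>, the functions \<open>s \<mapsto> P(t | s, y)\<close> average over \<open>y\<close> to \<open>s \<mapsto> P(t | s)\<close>, and by convexity of
  \<open>x log x\<close> the average of \<open>P(t | y) log P(t | y)\<close> is largest when the mass is put on the level sets of \<open>P(t | s)\<close>.

  Lower bounds.  Sharing time between two representations (with the choice revealed by \<open>Y\<close>) interpolates the
  constraint and the value linearly, so three representations suffice.  Two of them are families of independent copies
  of \<open>T\<close> given \<open>S = s\<close>, respectively given \<open>(X, S) = w\<close>.  The third one is the strong functional representation with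
  constants \<open>5.51\<close> and \<open>1.06\<close>: let exponential clocks \<open>e\<^sub>t\<close> race, with winner minimising \<open>e\<^sub>t / P(t | w)\<close>, and let \<open>Y\<close> be
  the discretised clocks.  Infinite alphabets are truncated, which costs an arbitrarily small amount and is
  harmless for a supremum.
\<close>

section \<open>Entropy and mutual information of discrete laws\<close>

text \<open>The lower bounds that depend on r are chords. In the plane of (bound on I(X;Y), value)
  the three representations sit at (H(X|S), H(T) - H(S)), (0, H(T) - H(X,S)) and (0, H(T) - I - log
  (I + 5.51) - 1.06), where I = I(X,S;T). Weight \<alpha> on the first and 1 - \<alpha> on the
  second gives \<open>L1\<close>; on the first and third it gives \<open>L3\<close>, by concavity of
  the logarithm. The obstacle is that Y may have infinite entropy, so I(Y;T) cannot be expanded into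
  entropies of Y. Estimates are made on the information density under the joint law, which is
  integrable once the other variable has finite entropy, and they reduce to log u \<le> (u - 1) / ln
  2. Lower bounds name a decoder's belief q(y,t) and use I(Y;T) \<ge> H(T) + E log q(Y,T); q needs
  total mass at most 1 only on average over Y, so its normalisation can be checked clock by clock.
  Constants: 5.51 exceeds 5 + log (17/16), where 5 = - log b for b = 1/32; and 1.06 = 3/2 - 0.44,
  where 3/2 comes from the choice of \<epsilon>.\<close>

lemma integrable_measure_pmf_iff_summable:
  fixes f :: "'a \<Rightarrow> real"
  shows "integrable (measure_pmf p) f \<longleftrightarrow> (\<lambda>x. pmf p x * f x) summable_on UNIV"
  by (subst summable_on_iff_abs_summable_on_real, subst abs_summable_equivalent,
      subst measure_pmf_eq_density, subst integrable_real_density)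
    (auto simp: abs_summable_on_def)

text \<open>Unconditional because the sum of a non-summable family and the integral of a
  non-integrable function are both 0 by convention.\<close>

lemma infsum_pmf_mult:
  fixes f :: "'a \<Rightarrow> real"
  shows "(\<Sum>\<^sub>\<infinity>x. pmf p x * f x) = measure_pmf.expectation p f"
proof (cases "integrable (measure_pmf p) f")
  case True
  then show ?thesis
    unfolding pmf_expectation_eq_infsetsum
    by (intro infsetsum_infsum[symmetric] abs_summable_equivalent[THEN iffD1]
        summable_on_iff_abs_summable_on_real[THEN iffD1])
      (simp add: integrable_measure_pmf_iff_summable)
next
  case False
  then show ?thesis
    by (simp add: not_integrable_integral_eq infsum_not_exists integrable_measure_pmf_iff_summable)
qed

lemma finite_ent_iff_integrable:
  "finite_ent p \<longleftrightarrow> integrable (measure_pmf p) (\<lambda>x. log 2 (pmf p x))"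
  unfolding finite_ent_def integrable_measure_pmf_iff_summable
  using summable_on_uminus[of "\<lambda>x. pmf p x * log 2 (pmf p x)" UNIV]
    summable_on_uminus[of "\<lambda>x. - pmf p x * log 2 (pmf p x)" UNIV] by auto

lemma ent_eq_expectation: "ent p = measure_pmf.expectation p (\<lambda>x. - log 2 (pmf p x))"
  unfolding ent_def infsum_pmf_mult[symmetric] by simp

lemma log2_pmf_nonpos: "log 2 (pmf p x) \<le> 0"
  using pmf_le_1[of p x] pmf_nonneg[of p x]
  by (cases "pmf p x = 0") (auto simp: log_def divide_nonpos_pos)

lemma ent_nonneg: "0 \<le> ent p"
  unfolding ent_eq_expectation by (intro integral_nonneg_AE) (simp add: log2_pmf_nonpos)

lemma pmf_map_ge: "pmf J z \<le> pmf (map_pmf f J) (f z)"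
  unfolding pmf_map
  by (subst measure_pmf_single[symmetric], rule measure_pmf.finite_measure_mono) auto

lemma pmf_map_pos: "z \<in> set_pmf J \<Longrightarrow> 0 < pmf (map_pmf f J) (f z)"
  by (simp add: pmf_positive)

lemma log2_le_minus_one: "0 < u \<Longrightarrow> log 2 u \<le> (u - 1) / ln 2"
  by (simp add: log_def divide_right_mono ln_le_minus_one)

text \<open>The average of g / J under J sums g over the support of J only, hence an inequality;
  outside the support the quotient is 0.\<close>

lemma expectation_ratio_le:
  fixes g :: "'a \<Rightarrow> real"
  assumes g: "\<And>z. 0 \<le> g z" and sub: "(\<integral>\<^sup>+z. ennreal (g z) \<partial>count_space UNIV) \<le> 1"
  shows "integrable (measure_pmf J) (\<lambda>z. g z / pmf J z)"
    and "measure_pmf.expectation J (\<lambda>z. g z / pmf J z) \<le> 1"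
proof -
  have "(\<integral>\<^sup>+z. ennreal (g z / pmf J z) \<partial>measure_pmf J)
      = (\<integral>\<^sup>+z. ennreal (pmf J z) * ennreal (g z / pmf J z) \<partial>count_space UNIV)"
    by (rule nn_integral_measure_pmf)
  also have "\<dots> \<le> (\<integral>\<^sup>+z. ennreal (g z) \<partial>count_space UNIV)"
    by (intro nn_integral_mono) (auto simp: ennreal_mult'[symmetric] g divide_simps)
  finally have le: "(\<integral>\<^sup>+z. ennreal (g z / pmf J z) \<partial>measure_pmf J) \<le> 1"
    using sub by (rule order.trans)
  then show i: "integrable (measure_pmf J) (\<lambda>z. g z / pmf J z)"
    by (intro integrableI_nonneg) (auto simp: g pmf_nonneg intro: le_less_trans[OF _ ennreal_one_less_top])
  show "measure_pmf.expectation J (\<lambda>z. g z / pmf J z) \<le> 1"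
    using le by (subst (asm) nn_integral_eq_integral[OF i]) (auto simp: g pmf_nonneg)
qed

text \<open>Averaging log u \<le> (u - 1) / ln 2 over u = g / J. Integrability is asked of the
  minorant \<open>f\<close> instead of the log ratio itself, and \<open>h\<close> lets the sample
  \<open>n\<close> carry variables that the comparison law \<open>g\<close> does not see.\<close>

lemma gibbs_inequality_map:
  fixes g :: "'a \<Rightarrow> real" and N :: "'n pmf"
  assumes g: "\<And>z. 0 \<le> g z" and sub: "(\<integral>\<^sup>+z. ennreal (g z) \<partial>count_space UNIV) \<le> 1"
    and pos: "\<And>n. n \<in> set_pmf N \<Longrightarrow> 0 < g (h n)"
    and f: "integrable (measure_pmf N) f"
    and le: "\<And>n. n \<in> set_pmf N \<Longrightarrow> f n \<le> log 2 (g (h n) / pmf (map_pmf h N) (h n))"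
  shows "measure_pmf.expectation N f \<le> 0"
proof -
  let ?J = "map_pmf h N"
  note r = expectation_ratio_le[OF g sub, of ?J]
  have "measure_pmf.expectation N f \<le> measure_pmf.expectation N (\<lambda>n. (g (h n) / pmf ?J (h n) - 1) / ln 2)"
  proof (intro integral_mono_AE f)
    show "AE n in measure_pmf N. f n \<le> (g (h n) / pmf ?J (h n) - 1) / ln 2"
      by (subst AE_measure_pmf_iff, intro ballI order.trans[OF le log2_le_minus_one])
        (simp_all add: pos pmf_positive)
  qed (use r in auto)
  also have "\<dots> = (measure_pmf.expectation ?J (\<lambda>z. g z / pmf ?J z) - 1) / ln 2"
    using r by simp
  also have "\<dots> \<le> 0" using r by (simp add: divide_nonpos_pos)
  finally show ?thesis .
qed

lemma gibbs_inequality: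
  fixes g :: "'a \<Rightarrow> real"
  assumes "\<And>z. 0 \<le> g z" "(\<integral>\<^sup>+z. ennreal (g z) \<partial>count_space UNIV) \<le> 1"
    and "\<And>z. z \<in> set_pmf J \<Longrightarrow> 0 < g z" "integrable (measure_pmf J) f"
    and "\<And>z. z \<in> set_pmf J \<Longrightarrow> f z \<le> log 2 (g z / pmf J z)"
  shows "measure_pmf.expectation J f \<le> 0"
  by (rule gibbs_inequality_map[where h = "\<lambda>z. z"]) (use assms in simp_all)

lemma nn_integral_pmf_UNIV: "(\<integral>\<^sup>+z. ennreal (pmf p z) \<partial>count_space UNIV) = 1"
  by (simp add: nn_integral_pmf)

section \<open>Information density (pointwise mutual information)\<close>

definition pmi :: "('a \<times> 'b) pmf \<Rightarrow> 'a \<times> 'b \<Rightarrow> real" where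
  "pmi J z = log 2 (pmf J z / (pmf (map_pmf fst J) (fst z) * pmf (map_pmf snd J) (snd z)))"

lemma mut_info_eq_expectation: "mut_info J = measure_pmf.expectation J (pmi J)"
  unfolding mut_info_def infsum_pmf_mult pmi_def ..

lemma nn_integral_prod_marginals:
  "(\<integral>\<^sup>+z. ennreal (pmf p (fst z) * pmf q (snd z)) \<partial>count_space UNIV) = 1"
proof -
  have "pmf p (fst z) * pmf q (snd z) = pmf (pair_pmf p q) z" for z
    by (cases z) (simp add: pmf_pair)
  then show ?thesis using nn_integral_pmf_UNIV[of "pair_pmf p q"] by simp
qed

lemma integrable_marginal_ratio:
  "integrable (measure_pmf J) (\<lambda>z. pmf (map_pmf fst J) (fst z) * pmf (map_pmf snd J) (snd z) / pmf J z)"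
  "measure_pmf.expectation J (\<lambda>z. pmf (map_pmf fst J) (fst z) * pmf (map_pmf snd J) (snd z) / pmf J z) \<le> 1"
  using expectation_ratio_le[of "\<lambda>z. pmf (map_pmf fst J) (fst z) * pmf (map_pmf snd J) (snd z)" J]
  by (simp_all add: nn_integral_prod_marginals)

lemma pmi_split:
  assumes "z \<in> set_pmf J"
  shows "pmi J z = log 2 (pmf J z) - log 2 (pmf (map_pmf fst J) (fst z)) - log 2 (pmf (map_pmf snd J) (snd z))"
  using pmf_positive[OF assms] pmf_map_pos[OF assms, of fst] pmf_map_pos[OF assms, of snd]
  by (simp add: pmi_def log_divide log_mult)

lemma pmi_lower:
  assumes "z \<in> set_pmf J"
  shows "- pmi J z \<le> (pmf (map_pmf fst J) (fst z) * pmf (map_pmf snd J) (snd z) / pmf J z - 1) / ln 2"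
proof -
  have "- pmi J z = log 2 (pmf (map_pmf fst J) (fst z) * pmf (map_pmf snd J) (snd z) / pmf J z)"
    using pmf_positive[OF assms] pmf_map_pos[OF assms, of fst] pmf_map_pos[OF assms, of snd]
    by (simp add: pmi_def log_divide log_mult)
  also have "\<dots> \<le> (pmf (map_pmf fst J) (fst z) * pmf (map_pmf snd J) (snd z) / pmf J z - 1) / ln 2"
    using pmf_positive[OF assms] pmf_map_pos[OF assms, of fst] pmf_map_pos[OF assms, of snd]
    by (intro log2_le_minus_one) simp
  finally show ?thesis .
qed

text \<open>The density is at most - log P(t), since J(y,t) \<le> P(y), and its negative is at most
  a multiple of the marginal ratio, which is always integrable. Thus the first component may have
  infinite entropy.\<close>

lemma integrable_pmi:
  assumes "finite_ent (map_pmf snd J)"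
  shows "integrable (measure_pmf J) (pmi J)"
proof (rule Bochner_Integration.integrable_bound)
  let ?z = "\<lambda>z. pmf (map_pmf fst J) (fst z) * pmf (map_pmf snd J) (snd z) / pmf J z"
  show "integrable (measure_pmf J) (\<lambda>z. - log 2 (pmf (map_pmf snd J) (snd z)) + ?z z / ln 2)"
    using assms integrable_marginal_ratio(1)[of J]
    by (intro Bochner_Integration.integrable_add integrable_divide) (auto simp: finite_ent_iff_integrable)
  show "AE z in measure_pmf J. norm (pmi J z) \<le> norm (- log 2 (pmf (map_pmf snd J) (snd z)) + ?z z / ln 2)"
  proof (subst AE_measure_pmf_iff, safe)
    fix y t assume z: "(y,t) \<in> set_pmf J"
    have "log 2 (pmf J (y,t)) \<le> log 2 (pmf (map_pmf fst J) y)"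
      using pmf_map_ge[of J "(y,t)" fst] pmf_positive[OF z] by simp
    then have a: "pmi J (y,t) \<le> - log 2 (pmf (map_pmf snd J) t)"
      using pmi_split[OF z] by simp
    have b: "- pmi J (y,t) \<le> ?z (y,t) / ln 2"
      by (rule order.trans[OF pmi_lower[OF z]], rule divide_right_mono) auto
    have c: "0 \<le> ?z (y,t) / ln 2" by simp
    have d: "0 \<le> - log 2 (pmf (map_pmf snd J) t)" using log2_pmf_nonpos by simp
    show "norm (pmi J (y,t)) \<le> norm (- log 2 (pmf (map_pmf snd J) (snd (y,t))) + ?z (y,t) / ln 2)"
      using a b c d unfolding real_norm_def snd_conv fst_conv by linarith
  qed
qed simp

lemma mut_info_nonneg:
  assumes "finite_ent (map_pmf snd J)"
  shows "0 \<le> mut_info J"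
proof -
  have "measure_pmf.expectation J (\<lambda>z. - pmi J z) \<le> 0"
  proof (rule gibbs_inequality)
    show "(\<integral>\<^sup>+z. ennreal (pmf (map_pmf fst J) (fst z) * pmf (map_pmf snd J) (snd z)) \<partial>count_space UNIV) \<le> 1"
      by (simp add: nn_integral_prod_marginals)
    show "- pmi J z \<le> log 2 (pmf (map_pmf fst J) (fst z) * pmf (map_pmf snd J) (snd z) / pmf J z)"
      if "z \<in> set_pmf J" for z
      using pmi_split[OF that] pmf_positive[OF that] pmf_map_pos[OF that, of fst] pmf_map_pos[OF that, of snd]
      by (simp add: log_divide log_mult)
  qed (use integrable_pmi[OF assms] in \<open>auto simp: pmf_map_pos\<close>)
  then show ?thesis by (simp add: mut_info_eq_expectation)
qed

lemma integrable_log_pmf_map_iff: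
  "integrable (measure_pmf p) (\<lambda>x. log 2 (pmf (map_pmf f p) (f x))) \<longleftrightarrow> finite_ent (map_pmf f p)"
  by (simp add: finite_ent_iff_integrable)

lemma ent_map_eq_expectation:
  "ent (map_pmf f p) = measure_pmf.expectation p (\<lambda>x. - log 2 (pmf (map_pmf f p) (f x)))"
  by (simp add: ent_eq_expectation)

lemma finite_ent_finite_support: "finite (set_pmf p) \<Longrightarrow> finite_ent p"
  unfolding finite_ent_iff_integrable by (rule integrable_measure_pmf_finite)

lemma finite_ent_map:
  assumes "finite_ent p"
  shows "finite_ent (map_pmf f p)"
  unfolding integrable_log_pmf_map_iff[symmetric]
proof (rule Bochner_Integration.integrable_bound)
  show "integrable (measure_pmf p) (\<lambda>x. log 2 (pmf p x))"
    using assms by (simp add: finite_ent_iff_integrable)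
  show "AE x in measure_pmf p. norm (log 2 (pmf (map_pmf f p) (f x))) \<le> norm (log 2 (pmf p x))"
  proof (subst AE_measure_pmf_iff, safe)
    fix x assume x: "x \<in> set_pmf p"
    have "log 2 (pmf p x) \<le> log 2 (pmf (map_pmf f p) (f x))"
      using pmf_map_ge[of p x f] pmf_positive[OF x] by simp
    with log2_pmf_nonpos[of "map_pmf f p" "f x"]
    show "norm (log 2 (pmf (map_pmf f p) (f x))) \<le> norm (log 2 (pmf p x))" by simp
  qed
qed simp

lemma
  assumes "finite_ent (map_pmf fst J)" "finite_ent (map_pmf snd J)"
  shows finite_ent_pair: "finite_ent J"
    and mut_info_eq_ent: "mut_info J = ent (map_pmf fst J) + ent (map_pmf snd J) - ent J"
proof -
  let ?a = "\<lambda>z. log 2 (pmf (map_pmf fst J) (fst z))" and ?b = "\<lambda>z. log 2 (pmf (map_pmf snd J) (snd z))"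
  have i: "integrable (measure_pmf J) ?a" "integrable (measure_pmf J) ?b" "integrable (measure_pmf J) (pmi J)"
    using assms integrable_pmi by (simp_all add: finite_ent_iff_integrable)
  have eq: "AE z in measure_pmf J. pmi J z + ?a z + ?b z = log 2 (pmf J z)"
    by (subst AE_measure_pmf_iff) (simp add: pmi_split)
  have "integrable (measure_pmf J) (\<lambda>z. pmi J z + ?a z + ?b z)"
    using i by simp
  then show "finite_ent J"
    unfolding finite_ent_iff_integrable by (subst integrable_cong_AE[symmetric, OF _ _ eq]) auto
  have "measure_pmf.expectation J (\<lambda>z. log 2 (pmf J z)) = measure_pmf.expectation J (\<lambda>z. pmi J z + ?a z + ?b z)"
    by (rule integral_cong_AE) (use eq in auto)
  also have "\<dots> = mut_info J - ent (map_pmf fst J) - ent (map_pmf snd J)"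
    using i by (simp add: mut_info_eq_expectation ent_eq_expectation)
  finally show "mut_info J = ent (map_pmf fst J) + ent (map_pmf snd J) - ent J"
    by (simp add: ent_eq_expectation)
qed

lemma pmi_map_inj:
  assumes f: "inj_on f (set_pmf (map_pmf fst J))" and g: "inj_on g (set_pmf (map_pmf snd J))"
    and z: "z \<in> set_pmf J"
  shows "pmi (map_pmf (map_prod f g) J) (map_prod f g z) = pmi J z"
proof -
  have "inj_on (map_prod f g) (set_pmf J)"
  proof (rule inj_onI)
    fix a b assume ab: "a \<in> set_pmf J" "b \<in> set_pmf J" and eq: "map_prod f g a = map_prod f g b"
    have "fst a = fst b"
      by (rule inj_onD[OF f]) (use ab eq in \<open>auto simp: map_prod_def split: prod.splits intro: rev_image_eqI\<close>)
    moreover have "snd a = snd b"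
      by (rule inj_onD[OF g]) (use ab eq in \<open>auto simp: map_prod_def split: prod.splits intro: rev_image_eqI\<close>)
    ultimately show "a = b" by (rule prod_eqI)
  qed
  then have 1: "pmf (map_pmf (map_prod f g) J) (map_prod f g z) = pmf J z"
    using z by (rule pmf_map_inj)
  have 2: "map_pmf fst (map_pmf (map_prod f g) J) = map_pmf f (map_pmf fst J)"
    "map_pmf snd (map_pmf (map_prod f g) J) = map_pmf g (map_pmf snd J)"
    by (simp_all add: map_pmf_comp)
  have 3: "pmf (map_pmf f (map_pmf fst J)) (f (fst z)) = pmf (map_pmf fst J) (fst z)"
    "pmf (map_pmf g (map_pmf snd J)) (g (snd z)) = pmf (map_pmf snd J) (snd z)"
    using z by (auto intro!: pmf_map_inj f g)
  show ?thesis unfolding pmi_def 1 2 by (simp only: fst_map_prod snd_map_prod 3)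
qed

text \<open>Injectivity is asked on the supports only, so that a representation over any type can be
  relabelled by an enumeration of its countable support.\<close>

lemma mut_info_map_inj:
  assumes f: "inj_on f (set_pmf (map_pmf fst J))" and g: "inj_on g (set_pmf (map_pmf snd J))"
  shows "mut_info (map_pmf (map_prod f g) J) = mut_info J"
  unfolding mut_info_eq_expectation integral_map_pmf
  by (intro integral_cong_AE) (auto simp: AE_measure_pmf_iff pmi_map_inj[OF assms] simp del: set_map_pmf)

lemma mut_info_swap: "mut_info (map_pmf (\<lambda>(a, b). (b, a)) J) = mut_info J"
proof -
  have "pmf (map_pmf (\<lambda>(a, b). (b, a)) J) (b, a) = pmf J (a, b)" for a b
    using pmf_map_inj'[of "\<lambda>(a, b). (b, a)" J "(a, b)"] by (auto simp: inj_on_def)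
  then have "pmi (map_pmf (\<lambda>(a, b). (b, a)) J) (case z of (a, b) \<Rightarrow> (b, a)) = pmi J z" for z
    by (cases z) (simp add: pmi_def map_pmf_comp case_prod_unfold mult.commute)
  then show ?thesis by (simp add: mut_info_eq_expectation)
qed

lemma mut_info_pair_pmf: "mut_info (pair_pmf p q) = 0"
proof -
  have "pmi (pair_pmf p q) = (\<lambda>z. 0)"
    by (rule ext) (auto simp: pmi_def map_fst_pair_pmf map_snd_pair_pmf pmf_pair log_def split: prod.split)
  then show ?thesis by (simp add: mut_info_eq_expectation)
qed

text \<open>Both sides have total mass one, so the nonnegative gap q - p sums to zero.\<close>

lemma pmf_eqI_le:
  assumes le: "\<And>x. pmf p x \<le> pmf q x"
  shows "p = q"
proof (rule pmf_eqI)
  fix x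
  have "ennreal (pmf q x) = ennreal (pmf p x) + ennreal (pmf q x - pmf p x)" for x
    using le by (subst ennreal_plus[symmetric]) auto
  then have "(\<integral>\<^sup>+x. pmf q x \<partial>count_space UNIV)
      = (\<integral>\<^sup>+x. ennreal (pmf p x) + ennreal (pmf q x - pmf p x) \<partial>count_space UNIV)" by simp
  also have "\<dots> = 1 + (\<integral>\<^sup>+x. pmf q x - pmf p x \<partial>count_space UNIV)"
    by (subst nn_integral_add) (auto simp: nn_integral_pmf_UNIV)
  finally have "(\<integral>\<^sup>+x. ennreal (pmf q x - pmf p x) \<partial>count_space UNIV) = 0"
    by (simp add: nn_integral_pmf_UNIV)
  then have "ennreal (pmf q x - pmf p x) = 0"
    by (subst (asm) nn_integral_0_iff_AE) (auto simp: AE_count_space)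
  then show "pmf p x = pmf q x"
    using le[of x] by (simp add: ennreal_eq_0_iff)
qed

lemma pmf_eqI_on_support:
  assumes "\<And>x. x \<in> set_pmf p \<Longrightarrow> pmf p x = pmf q x"
  shows "p = q"
proof (rule pmf_eqI_le)
  show "pmf p x \<le> pmf q x" for x
    using assms[of x] by (cases "x \<in> set_pmf p") (auto simp: set_pmf_iff)
qed

text \<open>The equality case of ln u \<le> u - 1: with u the ratio of the product of the marginals
  to J, the gap is nonnegative and has mean at most 0, so u = 1 on the support of J. Finite entropy
  ensures that the value 0 is a genuine mean and not the default for a divergent one.\<close>

lemma mut_info_zero_imp_indep:
  assumes fin: "finite_ent (map_pmf snd J)" and zero: "mut_info J = 0"
  shows "J = pair_pmf (map_pmf fst J) (map_pmf snd J)"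
proof (rule pmf_eqI_on_support)
  fix x assume x: "x \<in> set_pmf J"
  define z where "z x = pmf (map_pmf fst J) (fst x) * pmf (map_pmf snd J) (snd x) / pmf J x" for x
  have z: "integrable (measure_pmf J) z" "measure_pmf.expectation J z \<le> 1"
    unfolding z_def by (rule integrable_marginal_ratio)+
  have pos: "0 < z y" if "y \<in> set_pmf J" for y
    using that by (simp add: z_def pmf_map_pos pmf_positive)
  have pmi: "pmi J y = - ln (z y) / ln 2" if "y \<in> set_pmf J" for y
    using pmi_split[OF that] pmf_positive[OF that] pmf_map_pos[OF that, of fst] pmf_map_pos[OF that, of snd]
    by (simp add: z_def ln_div ln_mult log_def diff_divide_distrib add_divide_distrib)
  let ?d = "\<lambda>y. (z y - 1) / ln 2 + pmi J y"
  have i: "integrable (measure_pmf J) ?d"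
    using z integrable_pmi[OF fin] by simp
  have nn: "AE y in measure_pmf J. 0 \<le> ?d y"
  proof (subst AE_measure_pmf_iff, safe)
    fix a b assume y: "(a, b) \<in> set_pmf J"
    have "ln (z (a, b)) \<le> z (a, b) - 1" by (rule ln_le_minus_one[OF pos[OF y]])
    then have "0 \<le> (z (a, b) - 1 - ln (z (a, b))) / ln 2" by simp
    then show "0 \<le> ?d (a, b)" by (simp add: pmi[OF y] diff_divide_distrib)
  qed
  have "measure_pmf.expectation J ?d = (measure_pmf.expectation J z - 1) / ln 2"
    using z integrable_pmi[OF fin] zero by (simp add: mut_info_eq_expectation)
  also have "\<dots> \<le> 0" using z by (simp add: divide_nonpos_pos)
  finally have "measure_pmf.expectation J ?d = 0"
    using integral_nonneg_AE[OF nn] by simp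
  then have "AE y in measure_pmf J. ?d y = 0"
    using integral_nonneg_eq_0_iff_AE[OF i nn] by simp
  then have "?d x = 0" using x by (simp add: AE_measure_pmf_iff)
  then have "(z x - 1 - ln (z x)) / ln 2 = 0" by (simp add: pmi[OF x] diff_divide_distrib)
  then have "ln (z x) = z x - 1" by simp
  then have "z x = 1" using ln_eq_minus_one[OF pos[OF x]] by simp
  then show "pmf J x = pmf (pair_pmf (map_pmf fst J) (map_pmf snd J)) x"
    using pmf_positive[OF x] by (cases x) (simp add: z_def pmf_pair field_simps)
qed

section \<open>Data processing and the chain rule\<close>

lemma nn_integral_pmf_fst:
  "(\<integral>\<^sup>+y. ennreal (pmf J (y, t)) \<partial>count_space UNIV) = ennreal (pmf (map_pmf snd J) t)"
proof -
  have "ennreal (pmf (map_pmf snd J) t) = (\<integral>\<^sup>+z. indicator (snd -` {t}) z \<partial>measure_pmf J)"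
    by (simp add: ennreal_pmf_map)
  also have "\<dots> = (\<integral>\<^sup>+t'. \<integral>\<^sup>+y. ennreal (pmf J (y, t')) * indicator {t} t' \<partial>count_space UNIV \<partial>count_space UNIV)"
    unfolding nn_integral_measure_pmf nn_integral_snd_count_space[symmetric]
    by (intro nn_integral_cong) (auto split: split_indicator)
  also have "\<dots> = (\<integral>\<^sup>+t'. (\<integral>\<^sup>+y. ennreal (pmf J (y, t')) \<partial>count_space UNIV) * indicator {t} t' \<partial>count_space UNIV)"
    by (simp add: nn_integral_multc)
  also have "\<dots> = (\<integral>\<^sup>+y. ennreal (pmf J (y, t)) \<partial>count_space UNIV)"
    by (subst nn_integral_count_space_indicator[symmetric]) (simp_all add: nn_integral_count_space_finite)
  finally show ?thesis by simp
qed

text \<open>Gibbs' inequality against the law \<open>g\<close> under which y - h(t) - t is a Markov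
  chain with the given laws of (y, h(t)) and of t: the log ratio of \<open>g\<close> to J is the
  difference of the two information densities.\<close>

lemma mut_info_map_snd_le:
  assumes fin: "finite_ent (map_pmf snd J)"
  shows "mut_info (map_pmf (\<lambda>(y, t). (y, h t)) J) \<le> mut_info J"
proof -
  define J' where "J' = map_pmf (\<lambda>(y, t). (y, h t)) J"
  have fst: "map_pmf fst J' = map_pmf fst J" and snd: "map_pmf snd J' = map_pmf h (map_pmf snd J)"
    by (simp_all add: J'_def map_pmf_comp case_prod_unfold)
  have fin': "finite_ent (map_pmf snd J')" unfolding snd by (rule finite_ent_map[OF fin])
  define g where "g z = pmf (map_pmf snd J) (snd z) * (pmf J' (fst z, h (snd z)) / pmf (map_pmf snd J') (h (snd z)))" for z
  have i: "integrable (measure_pmf J) (\<lambda>z. pmi J' (fst z, h (snd z)))"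
    using integrable_pmi[OF fin'] by (simp add: J'_def case_prod_unfold)
  have "measure_pmf.expectation J (\<lambda>z. pmi J' (fst z, h (snd z)) - pmi J z) \<le> 0"
  proof (rule gibbs_inequality)
    show "0 \<le> g z" for z by (simp add: g_def)
    have "(\<integral>\<^sup>+z. ennreal (g z) \<partial>count_space UNIV) = (\<integral>\<^sup>+t. \<integral>\<^sup>+y. ennreal (g (y, t)) \<partial>count_space UNIV \<partial>count_space UNIV)"
      by (rule nn_integral_snd_count_space[symmetric])
    also have "\<dots> \<le> (\<integral>\<^sup>+t. ennreal (pmf (map_pmf snd J) t) \<partial>count_space UNIV)"
    proof (rule nn_integral_mono)
      fix t
      have "(\<integral>\<^sup>+y. ennreal (g (y, t)) \<partial>count_space UNIV)
          = (\<integral>\<^sup>+y. ennreal (pmf (map_pmf snd J) t / pmf (map_pmf snd J') (h t)) * ennreal (pmf J' (y, h t)) \<partial>count_space UNIV)"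
        by (simp add: g_def ennreal_mult'[symmetric] mult_ac)
      also have "\<dots> = ennreal (pmf (map_pmf snd J) t / pmf (map_pmf snd J') (h t)) * ennreal (pmf (map_pmf snd J') (h t))"
        by (subst nn_integral_cmult) (simp_all add: nn_integral_pmf_fst)
      also have "\<dots> \<le> ennreal (pmf (map_pmf snd J) t)"
        by (simp add: ennreal_mult'[symmetric])
      finally show "(\<integral>\<^sup>+y. ennreal (g (y, t)) \<partial>count_space UNIV) \<le> ennreal (pmf (map_pmf snd J) t)" .
    qed
    also have "\<dots> = 1" by (rule nn_integral_pmf_UNIV)
    finally show "(\<integral>\<^sup>+z. ennreal (g z) \<partial>count_space UNIV) \<le> 1" .
    fix z assume z: "z \<in> set_pmf J"
    then have z': "(fst z, h (snd z)) \<in> set_pmf J'" by (force simp: J'_def)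
    have p: "0 < pmf J z" "0 < pmf J' (fst z, h (snd z))" "0 < pmf (map_pmf snd J) (snd z)"
      "0 < pmf (map_pmf snd J') (h (snd z))" "0 < pmf (map_pmf fst J) (fst z)"
      using pmf_positive[OF z] pmf_positive[OF z'] pmf_map_pos[OF z, of fst] pmf_map_pos[OF z, of snd]
        pmf_map_pos[OF z', of snd] by simp_all
    then show "0 < g z" by (simp add: g_def)
    show "pmi J' (fst z, h (snd z)) - pmi J z \<le> log 2 (g z / pmf J z)"
      using p pmi_split[OF z] pmi_split[OF z'] by (simp add: g_def log_divide log_mult fst)
  qed (use i integrable_pmi[OF fin] in simp)
  then have "measure_pmf.expectation J (\<lambda>z. pmi J' (fst z, h (snd z))) \<le> mut_info J"
    using i integrable_pmi[OF fin] by (simp add: mut_info_eq_expectation)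
  then show ?thesis
    unfolding J'_def[symmetric] by (simp add: mut_info_eq_expectation) (simp add: J'_def case_prod_unfold)
qed

text \<open>I(Y;T) \<le> I(Y;X,T), and the density of (Y;(X,T)) is pointwise at most that of (Y;X)
  minus log P(t|x), because J(y,x,t) \<le> J(y,x).\<close>

lemma mut_info_le_add_cond_ent:
  fixes J :: "('y \<times> 'x \<times> 't) pmf"
  assumes x: "finite_ent (map_pmf (\<lambda>(y, x, t). x) J)" and t: "finite_ent (map_pmf (\<lambda>(y, x, t). t) J)"
  shows "mut_info (map_pmf (\<lambda>(y, x, t). (y, t)) J)
    \<le> mut_info (map_pmf (\<lambda>(y, x, t). (y, x)) J) + cond_ent (map_pmf (\<lambda>(y, x, t). (t, x)) J)"
proof -
  have "finite_ent (map_pmf (\<lambda>(y, x, t). (t, x)) J)" 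
    by (rule finite_ent_pair) (use x t in \<open>simp_all add: map_pmf_comp case_prod_unfold\<close>)
  then have tx: "integrable (measure_pmf J) (\<lambda>z. log 2 (pmf (map_pmf (\<lambda>(y, x, t). (t, x)) J) (snd (snd z), fst (snd z))))"
    by (simp add: finite_ent_iff_integrable case_prod_unfold)
  have fxt: "finite_ent (map_pmf snd J)"
    by (rule finite_ent_pair) (use x t in \<open>simp_all add: map_pmf_comp case_prod_unfold\<close>)
  let ?Jx = "map_pmf (\<lambda>(y, x, t). (y, x)) J" and ?TX = "map_pmf (\<lambda>(y, x, t). (t, x)) J"
  \<comment> \<open>\<open>cond_ent\<close> conditions on the second component, so (x,t) has to be
    reversed.\<close>
  have swap: "pmf (map_pmf snd J) (snd z) = pmf ?TX (snd (snd z), fst (snd z))" for z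
  proof -
    have "?TX = map_pmf prod.swap (map_pmf snd J)"
      by (simp add: map_pmf_comp case_prod_unfold prod.swap_def)
    then show ?thesis using pmf_map_inj'[of prod.swap "map_pmf snd J" "snd z"] by (simp add: prod.swap_def)
  qed
  have ix: "integrable (measure_pmf J) (\<lambda>z. pmi ?Jx (fst z, fst (snd z)))"
    using integrable_pmi[of ?Jx] x by (simp add: map_pmf_comp case_prod_unfold)
  have lx: "integrable (measure_pmf J) (\<lambda>z. log 2 (pmf (map_pmf (\<lambda>(y, x, t). x) J) (fst (snd z))))"
    using x by (simp add: finite_ent_iff_integrable case_prod_unfold)
  have "mut_info (map_pmf (\<lambda>(y, x, t). (y, t)) J) \<le> mut_info J"
    using mut_info_map_snd_le[OF fxt, of snd] by (simp add: case_prod_unfold)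
  also have "mut_info J \<le> measure_pmf.expectation J (\<lambda>z. pmi ?Jx (fst z, fst (snd z))
      - log 2 (pmf ?TX (snd (snd z), fst (snd z))) + log 2 (pmf (map_pmf (\<lambda>(y, x, t). x) J) (fst (snd z))))"
    unfolding mut_info_eq_expectation
  proof (rule integral_mono_AE)
    show "AE z in measure_pmf J. pmi J z \<le> pmi ?Jx (fst z, fst (snd z))
      - log 2 (pmf ?TX (snd (snd z), fst (snd z))) + log 2 (pmf (map_pmf (\<lambda>(y, x, t). x) J) (fst (snd z)))"
    proof (subst AE_measure_pmf_iff, rule ballI)
      fix z assume z: "z \<in> set_pmf J"
      then have z': "(fst z, fst (snd z)) \<in> set_pmf ?Jx" by (force simp: case_prod_unfold)
      have "log 2 (pmf J z) \<le> log 2 (pmf ?Jx (fst z, fst (snd z)))"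
        using pmf_map_ge[of J z "\<lambda>(y, x, t). (y, x)"] pmf_positive[OF z] by (simp add: case_prod_unfold)
      then show "pmi J z \<le> pmi ?Jx (fst z, fst (snd z))
      - log 2 (pmf ?TX (snd (snd z), fst (snd z))) + log 2 (pmf (map_pmf (\<lambda>(y, x, t). x) J) (fst (snd z)))"
        using pmi_split[OF z] pmi_split[OF z'] swap[of z] by (simp add: map_pmf_comp case_prod_unfold)
    qed
    show "integrable (measure_pmf J) (pmi J)" by (rule integrable_pmi[OF fxt])
  qed (use ix lx tx in simp)
  also have "\<dots> = mut_info ?Jx + cond_ent ?TX"
    using ix lx tx
    by (simp add: mut_info_eq_expectation cond_ent_def ent_eq_expectation map_pmf_comp case_prod_unfold)
  finally show ?thesis .
qed

section \<open>The level set bound\<close>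

lemma xlog_nonpos: "0 \<le> x \<Longrightarrow> x \<le> 1 \<Longrightarrow> x * log 2 x \<le> 0"
  by (cases "x = 0") (auto intro!: mult_nonneg_nonpos)

lemma xlog_tangent:
  fixes x a :: real
  assumes "0 \<le> x" "0 < a"
  shows "a * log 2 a + (log 2 a + 1 / ln 2) * (x - a) \<le> x * log 2 x"
proof (cases "x = 0")
  case True
  then show ?thesis using assms by (simp add: algebra_simps)
next
  case False
  with assms have x: "0 < x" by simp
  have "log 2 (a / x) \<le> (a / x - 1) / ln 2"
    using x assms by (intro log2_le_minus_one) simp
  then have "x * log 2 (a / x) \<le> x * ((a / x - 1) / ln 2)"
    using x by (intro mult_left_mono) auto
  also have "\<dots> = (a - x) / ln 2" using x by (simp add: field_simps)
  finally have "x * (log 2 a - log 2 x) \<le> (a - x) / ln 2"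
    using x assms by (simp add: log_divide)
  then show ?thesis by (simp add: algebra_simps diff_divide_distrib)
qed

text \<open>Tangent lines at the mean include the endpoint 0, where the function is not
  differentiable; a zero mean forces both weighted points to vanish.\<close>

lemma convex_on_xlog: "convex_on {0..} (\<lambda>x::real. x * log 2 x)"
proof (rule convex_onI)
  fix t x y :: real
  assume t: "0 < t" "t < 1" and xy: "x \<in> {0..}" "y \<in> {0..}"
  define m where "m = (1 - t) * x + t * y"
  have m: "0 \<le> m" using t xy by (simp add: m_def)
  have "m * log 2 m \<le> (1 - t) * (x * log 2 x) + t * (y * log 2 y)"
  proof (cases "m = 0")
    case True
    then have "(1 - t) * x = 0" "t * y = 0"
      unfolding m_def using t xy by (auto simp: add_nonneg_eq_0_iff)
    then show ?thesis using True t by simp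
  next
    case False
    with m have m: "0 < m" by simp
    define k where "k = log 2 m + 1 / ln 2"
    have "(1 - t) * (m * log 2 m + k * (x - m)) + t * (m * log 2 m + k * (y - m))
        \<le> (1 - t) * (x * log 2 x) + t * (y * log 2 y)"
      unfolding k_def using t xy m by (intro add_mono mult_left_mono xlog_tangent) auto
    also have "(1 - t) * (m * log 2 m + k * (x - m)) + t * (m * log 2 m + k * (y - m))
        = m * log 2 m + k * ((1 - t) * x + t * y - m)"
      by (simp add: algebra_simps)
    finally show ?thesis by (simp add: m_def)
  qed
  then show "((1 - t) *\<^sub>R x + t *\<^sub>R y) * log 2 ((1 - t) *\<^sub>R x + t *\<^sub>R y)
      \<le> (1 - t) * (x * log 2 x) + t * (y * log 2 y)"
    by (simp add: m_def)
qed simp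

text \<open>The inner points e + h and c are convex combinations of the outer points e and c + h
  with exchanged weights, so adding the two convexity inequalities gives the claim.\<close>

lemma convex_increment_mono:
  fixes f :: "real \<Rightarrow> real"
  assumes f: "convex_on {0..} f" and "0 \<le> e" "e \<le> c" "0 \<le> h"
  shows "f (e + h) - f e \<le> f (c + h) - f c"
proof (cases "c + h = e")
  case True
  then have "h = 0" "c = e" using assms by auto
  then show ?thesis by simp
next
  case False
  define d where "d = c + h - e"
  define t where "t = h / d"
  have d: "0 < d" using False assms by (simp add: d_def)
  have t: "0 \<le> t" "t \<le> 1" using assms d by (auto simp: t_def d_def)
  have td: "t * d = h" using d by (simp add: t_def)
  have "(1 - t) * e + t * (c + h) = e + t * d" "(1 - (1 - t)) * e + (1 - t) * (c + h) = c + h - t * d"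
    by (simp_all add: d_def algebra_simps)
  then have eq: "(1 - t) * e + t * (c + h) = e + h" "(1 - (1 - t)) * e + (1 - t) * (c + h) = c"
    by (simp_all add: td)
  have "f (e + h) \<le> (1 - t) * f e + t * f (c + h)"
    using convex_onD[OF f, of t e "c + h"] t assms eq(1) by simp
  moreover have "f c \<le> t * f e + (1 - t) * f (c + h)"
    using convex_onD[OF f, of "1 - t" e "c + h"] t assms eq(2) by simp
  ultimately show ?thesis by (simp add: algebra_simps)
qed

text \<open>Items are added one at a time. The partial sum with weights f lies below the full
  cumulative mass, so moving the increment of F up to that mass can only enlarge it; there,
  convexity compares the fraction f(n) of the step with the whole step.\<close>

lemma convex_greedy_bound:
  fixes F :: "real \<Rightarrow> real" and p f :: "nat \<Rightarrow> real"
  assumes F: "convex_on {0..} F" and F0: "F 0 = 0"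
    and p: "\<And>i. 0 \<le> p i" and f: "\<And>i. 0 \<le> f i" "\<And>i. f i \<le> 1"
  shows "F (\<Sum>i<n. p i * f i) \<le> (\<Sum>i<n. f i * (F (\<Sum>j<Suc i. p j) - F (\<Sum>j<i. p j)))"
proof (induction n)
  case 0
  then show ?case by (simp add: F0)
next
  case (Suc n)
  let ?e = "\<Sum>i<n. p i * f i" and ?c = "\<Sum>j<n. p j"
  have e: "0 \<le> ?e" "?e \<le> ?c" "0 \<le> ?c"
    using p f by (auto intro!: sum_nonneg sum_mono mult_left_le)
  have "F (?e + p n * f n) - F ?e \<le> F (?c + p n * f n) - F ?c"
    by (rule convex_increment_mono[OF F]) (use e p f in auto)
  also have "F (?c + p n * f n) \<le> (1 - f n) * F ?c + f n * F (?c + p n)"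
    using convex_onD[OF F, of "f n" ?c "?c + p n"] e p[of n] f[of n] by (simp add: algebra_simps)
  finally have "F (?e + p n * f n) - F ?e \<le> f n * (F (?c + p n) - F ?c)"
    by (simp add: algebra_simps)
  with Suc show ?case by simp
qed

text \<open>With c antitone, the indices at level m or higher form an initial segment, over which
  the increments telescope.\<close>

lemma sum_level_set_increments:
  fixes G :: "nat \<Rightarrow> real" and c :: "nat \<Rightarrow> real"
  assumes anti: "\<And>i j. i \<le> j \<Longrightarrow> j < n \<Longrightarrow> c j \<le> c i" and G: "G 0 = 0"
  obtains k where "{i. i < n \<and> m \<le> c i} = {..<k}"
    "(\<Sum>i<n. indicator {..c i} m * (G (Suc i) - G i)) = G k"
proof -
  define A where "A = {i. i < n \<and> m \<le> c i}"
  have down: "i \<in> A" if "i \<le> j" "j \<in> A" for i j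
    using that anti[of i j] by (auto simp: A_def)
  have "finite A" by (simp add: A_def)
  have A: "A = {..<card A}"
  proof -
    have "{..j} \<subseteq> A" if "j \<in> A" for j using down that by auto
    then have lt: "j < card A" if "j \<in> A" for j
      using card_mono[OF \<open>finite A\<close>, of "{..j}"] that by fastforce
    then have "A \<subseteq> {..<card A}" by auto
    then show ?thesis by (intro card_subset_eq) auto
  qed
  have "(\<Sum>i<n. indicator {..c i} m * (G (Suc i) - G i)) = (\<Sum>i\<in>A. G (Suc i) - G i)"
    unfolding A_def by (intro sum.mono_neutral_cong_right) (auto simp: indicator_def)
  also have "\<dots> = (\<Sum>i<card A. G (Suc i) - G i)" using A by simp
  also have "\<dots> = G (card A)" by (simp add: sum_lessThan_telescope G)
  finally show ?thesis using that A by (simp add: A_def)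
qed

lemma antitone_enumeration:
  fixes c :: "'s \<Rightarrow> real"
  assumes "finite A"
  obtains \<sigma> where "bij_betw \<sigma> {..<card A} A"
    "\<And>i j. i \<le> j \<Longrightarrow> j < card A \<Longrightarrow> c (\<sigma> j) \<le> c (\<sigma> i)"
proof -
  obtain xs where xs: "set xs = A" "distinct xs" using finite_distinct_list[OF assms] by blast
  define ys where "ys = sort_key (\<lambda>s. - c s) xs"
  have ys: "set ys = A" "distinct ys" "sorted (map (\<lambda>s. - c s) ys)" using xs by (simp_all add: ys_def)
  then have len: "length ys = card A" by (metis distinct_card)
  show ?thesis
  proof (rule that[of "\<lambda>i. ys ! i"])
    show "bij_betw ((!) ys) {..<card A} A" using ys len by (intro bij_betw_nth) auto
    show "c (ys ! j) \<le> c (ys ! i)" if "i \<le> j" "j < card A" for i j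
      using sorted_nth_mono[OF ys(3) that(1)] that len by simp
  qed
qed

lemma integral_indicator_atMost:
  fixes c :: real
  assumes "0 \<le> c" "c \<le> 1"
  shows "((\<lambda>m. indicator {..c} m * k) has_integral c * k) {0..1::real}"
proof -
  have "((\<lambda>m. k) has_integral c * k) {0..c}"
    using has_integral_const_real[of k 0 c] assms by simp
  then have "((\<lambda>m. if m \<in> {0..c} then k else 0) has_integral c * k) {0..1}"
    by (subst has_integral_restrict) (use assms in auto)
  then show ?thesis
    by (rule has_integral_eq[rotated]) (auto simp: indicator_def)
qed

text \<open>The weights \<open>d\<close> are the increments of \<open>x log x\<close> along the cumulative masses of the level sets of \<open>c\<close>
  (a subgradient of the Lovasz extension of the supermodular function \<open>A \<mapsto> p(A) log p(A)\<close>).\<close>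

lemma level_set_subgradient:
  fixes p :: "'s::finite pmf" and c :: "'s \<Rightarrow> real"
  assumes c: "\<And>s. 0 \<le> c s" "\<And>s. c s \<le> 1"
  obtains d :: "'s \<Rightarrow> real" where
    "\<And>f. (\<And>s. 0 \<le> f s) \<Longrightarrow> (\<And>s. f s \<le> 1) \<Longrightarrow>
      (\<Sum>s\<in>UNIV. pmf p s * f s) * log 2 (\<Sum>s\<in>UNIV. pmf p s * f s) \<le> (\<Sum>s\<in>UNIV. f s * d s)"
    "((\<lambda>m. measure_pmf.prob p {s. c s \<ge> m} * log 2 (measure_pmf.prob p {s. c s \<ge> m}))
      has_integral (\<Sum>s\<in>UNIV. c s * d s)) {0..1}"
proof -
  define n where "n = card (UNIV :: 's set)"
  obtain \<sigma> where \<sigma>: "bij_betw \<sigma> {..<n} (UNIV :: 's set)"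
    and anti: "\<And>i j. i \<le> j \<Longrightarrow> j < n \<Longrightarrow> c (\<sigma> j) \<le> c (\<sigma> i)"
    using antitone_enumeration[of "UNIV :: 's set" c] unfolding n_def by auto
  define F where "F = (\<lambda>x::real. x * log 2 x)"
  define q where "q i = pmf p (\<sigma> i)" for i
  define G where "G k = F (\<Sum>j<k. q j)" for k
  define d where "d s = (let i = inv_into {..<n} \<sigma> s in G (Suc i) - G i)" for s
  have d: "d (\<sigma> i) = G (Suc i) - G i" if "i < n" for i
    using bij_betw_inv_into_left[OF \<sigma>] that by (simp add: d_def)
  have sum: "(\<Sum>s\<in>UNIV. h s) = (\<Sum>i<n. h (\<sigma> i))" for h :: "'s \<Rightarrow> real"
    using sum.reindex_bij_betw[OF \<sigma>, of h] by simp
  show ?thesis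
  proof (rule that[of d])
    fix f :: "'s \<Rightarrow> real" assume f: "\<And>s. 0 \<le> f s" "\<And>s. f s \<le> 1"
    have "F (\<Sum>i<n. q i * f (\<sigma> i)) \<le> (\<Sum>i<n. f (\<sigma> i) * (F (\<Sum>j<Suc i. q j) - F (\<Sum>j<i. q j)))"
      by (rule convex_greedy_bound) (auto simp: F_def convex_on_xlog q_def f)
    then show "(\<Sum>s\<in>UNIV. pmf p s * f s) * log 2 (\<Sum>s\<in>UNIV. pmf p s * f s) \<le> (\<Sum>s\<in>UNIV. f s * d s)"
      by (simp add: sum d F_def q_def G_def)
  next
    \<comment> \<open>Layer cake: each c(s) is the integral over m of the indicator of m \<le> c(s).
      Summing over s inside the integral instead gives F of the mass of the level set at m.\<close>
    have "((\<lambda>m. \<Sum>i<n. indicator {..c (\<sigma> i)} m * (G (Suc i) - G i)) has_integral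
        (\<Sum>i<n. c (\<sigma> i) * (G (Suc i) - G i))) {0..1}"
      by (intro has_integral_sum integral_indicator_atMost c) auto
    moreover have "(\<Sum>i<n. indicator {..c (\<sigma> i)} m * (G (Suc i) - G i))
        = F (measure_pmf.prob p {s. c s \<ge> m})" for m
    proof -
      obtain k where k: "{i. i < n \<and> m \<le> c (\<sigma> i)} = {..<k}"
        "(\<Sum>i<n. indicator {..c (\<sigma> i)} m * (G (Suc i) - G i)) = G k"
        by (rule sum_level_set_increments[of n "\<lambda>i. c (\<sigma> i)" G m]) (auto simp: anti G_def F_def)
      have "measure_pmf.prob p {s. c s \<ge> m} = (\<Sum>s\<in>UNIV. if m \<le> c s then pmf p s else 0)"
        by (subst measure_measure_pmf_finite) (auto simp: sum.If_cases)
      also have "\<dots> = (\<Sum>i<n. if m \<le> c (\<sigma> i) then q i else 0)" unfolding sum q_def ..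
      also have "\<dots> = (\<Sum>i<k. q i)"
        unfolding k(1)[symmetric] by (intro sum.mono_neutral_cong_right) auto
      finally show ?thesis unfolding k(2) by (simp add: G_def)
    qed
    ultimately show "((\<lambda>m. measure_pmf.prob p {s. c s \<ge> m} * log 2 (measure_pmf.prob p {s. c s \<ge> m}))
      has_integral (\<Sum>s\<in>UNIV. c s * d s)) {0..1}"
      by (simp add: sum d F_def)
  qed
qed

section \<open>From level sets to the bound on I(Y;T)\<close>

lemma sum_pmf_fst:
  fixes J :: "('s::finite \<times> 'a) pmf"
  shows "(\<Sum>s\<in>UNIV. pmf J (s, a)) = pmf (map_pmf snd J) a"
proof -
  have "snd -` {a} = (\<lambda>s::'s. (s, a)) ` UNIV" by auto
  then have "pmf (map_pmf snd J) a = measure_pmf.prob J ((\<lambda>s. (s, a)) ` UNIV)"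
    by (simp add: pmf_map)
  also have "\<dots> = (\<Sum>s\<in>UNIV. pmf J (s, a))"
    by (subst measure_measure_pmf_finite) (auto simp: sum.reindex inj_on_def)
  finally show ?thesis by simp
qed

lemma has_sum_pmf_snd:
  "((\<lambda>y. pmf J (t, y)) has_sum pmf (map_pmf fst J) t) UNIV"
proof -
  have "(pmf J has_sum pmf (map_pmf fst J) t) (fst -` {t})"
    unfolding pmf_map
    by (metis abs_summable_equivalent has_sum_infsum infsetsum_infsum measure_pmf_conv_infsetsum
        pmf_abs_summable summable_on_iff_abs_summable_on_real)
  moreover have eq: "fst -` {t} = Pair t ` UNIV" by auto
  ultimately show ?thesis
    unfolding eq by (subst (asm) has_sum_reindex) (simp_all add: inj_on_def o_def)
qed

lemma has_sum_sum_finite: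
  fixes f :: "'i \<Rightarrow> 'a \<Rightarrow> real"
  assumes "finite I" "\<And>i. i \<in> I \<Longrightarrow> (f i has_sum c i) A"
  shows "((\<lambda>x. \<Sum>i\<in>I. f i x) has_sum (\<Sum>i\<in>I. c i)) A"
  using assms by (induction I rule: finite_induct) (auto intro: has_sum_add)

text \<open>I(Y;T) - H(T) is the sum over t of \<open>a t\<close>, the mean over y of P(t|y) log
  P(t|y). For fixed t the weights \<open>d\<close> bound each term by a linear functional of s
  \<mapsto> P(t|s,y). As \<open>d\<close> does not depend on y, averaging over y is exact and leaves
  the functional at P(t|s), which is the integral \<open>B t\<close>.\<close>

lemma mut_info_le_level_bound:
  fixes J :: "('s::finite \<times> 't \<times> 'y) pmf"
  defines "PS \<equiv> map_pmf fst J" and "PY \<equiv> map_pmf (\<lambda>(s, t, y). y) J"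
  defines "PST \<equiv> map_pmf (\<lambda>(s, t, y). (s, t)) J" and "PT \<equiv> map_pmf (\<lambda>(s, t, y). t) J"
  assumes fin: "finite_ent PT" and indep: "map_pmf (\<lambda>(s, t, y). (s, y)) J = pair_pmf PS PY"
  shows "mut_info (map_pmf (\<lambda>(s, t, y). (y, t)) J) \<le> ent PT +
    (\<Sum>\<^sub>\<infinity>t. integral {0..1} (\<lambda>m.
        measure_pmf.prob PS {s. pmf PST (s, t) / pmf PS s \<ge> m} *
        log 2 (measure_pmf.prob PS {s. pmf PST (s, t) / pmf PS s \<ge> m})))"
proof -
  define K where "K = map_pmf snd J"
  define c where "c t s = pmf PST (s, t) / pmf PS s" for t s
  define B where "B t = integral {0..1} (\<lambda>m. measure_pmf.prob PS {s. c t s \<ge> m} *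
        log 2 (measure_pmf.prob PS {s. c t s \<ge> m}))" for t
  define l where "l z = log 2 (pmf K z / pmf PY (snd z))" for z
  define a where "a t = (\<Sum>\<^sub>\<infinity>y. pmf K (t, y) * l (t, y))" for t
  have K: "map_pmf fst K = PT" "map_pmf snd K = PY" "map_pmf (\<lambda>(s, t, y). (y, t)) J = map_pmf (\<lambda>(t, y). (y, t)) K"
    by (simp_all add: K_def PT_def PY_def map_pmf_comp case_prod_unfold)
  have PST: "map_pmf fst PST = PS" by (simp add: PST_def PS_def map_pmf_comp case_prod_unfold)
  have pmi: "pmi K z = l z - log 2 (pmf PT (fst z))" if "z \<in> set_pmf K" for z
    using pmi_split[OF that] pmf_positive[OF that] pmf_map_pos[OF that, of snd]
    by (simp add: l_def K log_divide)
  have iT: "integrable (measure_pmf K) (\<lambda>z. log 2 (pmf PT (fst z)))"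
    using fin unfolding K(1)[symmetric] by (simp add: finite_ent_iff_integrable)
  have iK: "integrable (measure_pmf K) (pmi K)"
  proof -
    have "integrable (measure_pmf (map_pmf (\<lambda>(t, y). (y, t)) K)) (pmi (map_pmf (\<lambda>(t, y). (y, t)) K))"
      by (rule integrable_pmi) (use fin in \<open>simp add: map_pmf_comp case_prod_unfold K\<close>)
    moreover have "pmi (map_pmf (\<lambda>(t, y). (y, t)) K) (case z of (t, y) \<Rightarrow> (y, t)) = pmi K z" for z
      using pmf_map_inj'[of "\<lambda>(a, b). (b, a)" K z]
      by (cases z) (auto simp: pmi_def map_pmf_comp case_prod_unfold mult.commute inj_on_def)
    ultimately show ?thesis by (simp add: case_prod_unfold)
  qed
  have eq: "AE z in measure_pmf K. pmi K z + log 2 (pmf PT (fst z)) = l z"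
    by (simp add: AE_measure_pmf_iff pmi)
  have il: "integrable (measure_pmf K) l"
    using integrable_cong_AE[THEN iffD1, OF _ _ eq] iK iT by simp
  have "mut_info K = measure_pmf.expectation K (\<lambda>z. l z - log 2 (pmf PT (fst z)))"
    unfolding mut_info_eq_expectation by (intro integral_cong_AE) (auto simp: AE_measure_pmf_iff pmi)
  also have "\<dots> = measure_pmf.expectation K l + ent PT"
    using il iT by (simp add: ent_eq_expectation flip: K(1))
  also have "measure_pmf.expectation K l = (\<Sum>\<^sub>\<infinity>(t, y). pmf K (t, y) * l (t, y))"
    by (simp add: infsum_pmf_mult[symmetric] case_prod_unfold)
  also have "\<dots> = (\<Sum>\<^sub>\<infinity>t. a t)"
  proof -
    have "(\<lambda>(t, y). pmf K (t, y) * l (t, y)) summable_on UNIV \<times> UNIV"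
      using il by (simp add: integrable_measure_pmf_iff_summable case_prod_unfold)
    from infsum_Sigma'_banach[OF this] show ?thesis by (simp add: a_def)
  qed
  finally have I: "mut_info K = (\<Sum>\<^sub>\<infinity>t. a t) + ent PT" .
  have sum2: "(\<lambda>(t, y). pmf K (t, y) * l (t, y)) summable_on UNIV \<times> UNIV"
    using il by (simp add: integrable_measure_pmf_iff_summable case_prod_unfold)
  have sum_a: "a summable_on UNIV"
    using summable_on_Sigma_banach[OF sum2] by (simp add: a_def[abs_def])
  have sum_y: "(\<lambda>y. pmf K (t, y) * l (t, y)) summable_on UNIV" for t
    using summable_on_SigmaD1[of "\<lambda>t y. pmf K (t, y) * l (t, y)" UNIV "\<lambda>_. UNIV" t] sum2 by simp
  have aB: "a t \<le> B t" for t
  proof -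
    have c: "0 \<le> c t s" "c t s \<le> 1" for s
      using pmf_map_ge[of PST "(s, t)" fst] unfolding PST by (auto simp: c_def divide_le_eq_1)
    obtain d where d: "\<And>f. (\<And>s. 0 \<le> f s) \<Longrightarrow> (\<And>s. f s \<le> 1) \<Longrightarrow>
      (\<Sum>s\<in>UNIV. pmf PS s * f s) * log 2 (\<Sum>s\<in>UNIV. pmf PS s * f s) \<le> (\<Sum>s\<in>UNIV. f s * d s)"
    and int: "((\<lambda>m. measure_pmf.prob PS {s. c t s \<ge> m} * log 2 (measure_pmf.prob PS {s. c t s \<ge> m}))
      has_integral (\<Sum>s\<in>UNIV. c t s * d s)) {0..1}"
      using level_set_subgradient[of "c t" PS] c by blast
    have y: "pmf K (t, y) * l (t, y) \<le> (\<Sum>s\<in>UNIV. pmf J (s, t, y) * (d s / pmf PS s))" for y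
    proof (cases "pmf PY y = 0")
      case True
      have "pmf K (t, y) = 0"
        using pmf_map_ge[of K "(t, y)" snd] True by (simp add: K antisym)
      moreover have "pmf J (s, t, y) = 0" for s
        using pmf_map_ge[of J "(s, t, y)" "\<lambda>(s, t, y). y"] True by (simp add: PY_def antisym)
      ultimately show ?thesis by simp
    next
      case False
      then have py: "0 < pmf PY y" by (simp add: pmf_pos)
      \<comment> \<open>By independence the denominator is the mass of (s,y), so this is P(t|s,y),
        and its mean over s is P(t|y). Where P(s) = 0 the quotient is 0, which changes no sum since
        J vanishes there too.\<close>
      define f where "f s = pmf J (s, t, y) / (pmf PS s * pmf PY y)" for s
      have J0: "pmf J (s, t, y) = 0" if "pmf PS s = 0" for s
        using pmf_map_ge[of J "(s, t, y)" fst] that by (simp add: PS_def antisym)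
      have "pmf J (s, t, y) \<le> pmf PS s * pmf PY y" for s
        using pmf_map_ge[of J "(s, t, y)" "\<lambda>(s, t, y). (s, y)"] by (simp add: indep pmf_pair)
      then have f: "0 \<le> f s" "f s \<le> 1" for s
        using py by (cases "pmf PS s = 0"; simp add: f_def divide_le_eq_1 pmf_pos)+
      have pf: "pmf PS s * f s = pmf J (s, t, y) / pmf PY y" for s
        using J0[of s] by (simp add: f_def)
      have "(\<Sum>s\<in>UNIV. pmf PS s * f s) = pmf K (t, y) / pmf PY y"
        unfolding pf by (simp add: sum_divide_distrib[symmetric] sum_pmf_fst K_def)
      with d[of f] f have "pmf K (t, y) / pmf PY y * l (t, y) \<le> (\<Sum>s\<in>UNIV. f s * d s)"
        by (simp add: l_def)
      then have "pmf PY y * (pmf K (t, y) / pmf PY y * l (t, y)) \<le> pmf PY y * (\<Sum>s\<in>UNIV. f s * d s)"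
        by (intro mult_left_mono) auto
      then show ?thesis
        using py by (simp add: sum_distrib_left f_def)
    qed
    have "((\<lambda>y. \<Sum>s\<in>UNIV. pmf J (s, t, y) * (d s / pmf PS s)) has_sum
        (\<Sum>s\<in>UNIV. pmf PST (s, t) * (d s / pmf PS s))) UNIV"
    proof (intro has_sum_sum_finite has_sum_cmult_left finite)
      fix s
      have "map_pmf fst (map_pmf (\<lambda>(s, t, y). ((s, t), y)) J) = PST"
        by (simp add: PST_def map_pmf_comp case_prod_unfold)
      moreover have "pmf (map_pmf (\<lambda>(s, t, y). ((s, t), y)) J) ((s, t), y) = pmf J (s, t, y)" for y
        using pmf_map_inj'[of "\<lambda>(s, t, y). ((s, t), y)" J "(s, t, y)"] by (auto simp: inj_on_def)
      ultimately show "((\<lambda>y. pmf J (s, t, y)) has_sum pmf PST (s, t)) UNIV"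
        using has_sum_pmf_snd[of "map_pmf (\<lambda>(s, t, y). ((s, t), y)) J" "(s, t)"] by simp
    qed
    then have "a t \<le> (\<Sum>s\<in>UNIV. pmf PST (s, t) * (d s / pmf PS s))"
      unfolding a_def by (rule has_sum_mono[OF has_sum_infsum[OF sum_y] _ y])
    also have "\<dots> = B t"
      using integral_unique[OF int] by (simp add: B_def c_def)
    finally show ?thesis .
  qed
  have B0: "B t \<le> 0" for t
  proof (cases "(\<lambda>m. measure_pmf.prob PS {s. c t s \<ge> m} *
        log 2 (measure_pmf.prob PS {s. c t s \<ge> m})) integrable_on {0..1}")
    case True
    have "B t \<le> integral {0..1::real} (\<lambda>m. 0)"
      unfolding B_def
    proof (rule integral_le[OF True])
      fix m
      show "measure_pmf.prob PS {s. c t s \<ge> m} * log 2 (measure_pmf.prob PS {s. c t s \<ge> m}) \<le> 0"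
        by (rule xlog_nonpos) simp_all
    qed (rule integrable_0)
    then show ?thesis by simp
  next
    case False
    then show ?thesis by (simp add: B_def not_integrable_integral)
  qed
  \<comment> \<open>From a \<le> B \<le> 0. Without summability the infinite sum in
    \<open>U0\<close> would be the default 0 and the comparison of the two sums would not be
    available.\<close>
  have sum_B: "B summable_on UNIV"
  proof -
    have "(\<lambda>t. - a t) summable_on UNIV" using sum_a summable_on_uminus[of a UNIV] by simp
    then have "(\<lambda>t. - B t) summable_on UNIV"
      by (rule summable_on_comparison_test) (use aB B0 in auto)
    then show ?thesis using summable_on_uminus[of B UNIV] by simp
  qed
  have "(\<Sum>\<^sub>\<infinity>t. a t) \<le> (\<Sum>\<^sub>\<infinity>t. B t)"
    by (rule infsum_mono[OF sum_a sum_B aB])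
  with I show ?thesis
    unfolding K(3) mut_info_swap B_def c_def by simp
qed

section \<open>Representations and time sharing\<close>

text \<open>Gibbs' inequality for the law of (Y,T) against P(y) q(y,t). The belief q may have mass
  above 1 for some y as long as the average over Y is at most 1, and \<open>l\<close> is an
  integrable minorant of its logarithm.\<close>

lemma mut_info_ge_belief:
  fixes N :: "'n pmf" and Y :: "'n \<Rightarrow> 'y" and T :: "'n \<Rightarrow> 't" and q :: "'y \<Rightarrow> 't \<Rightarrow> real"
  assumes fin: "finite_ent (map_pmf T N)" and q: "\<And>y t. 0 \<le> q y t"
    and sub: "(\<integral>\<^sup>+y. (\<integral>\<^sup>+t. ennreal (q y t) \<partial>count_space UNIV) \<partial>measure_pmf (map_pmf Y N)) \<le> 1"
    and pos: "\<And>n. n \<in> set_pmf N \<Longrightarrow> 0 < q (Y n) (T n)"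
    and l: "integrable (measure_pmf N) l"
    and le: "\<And>n. n \<in> set_pmf N \<Longrightarrow> l n \<le> log 2 (q (Y n) (T n))"
  shows "ent (map_pmf T N) + measure_pmf.expectation N l \<le> mut_info (map_pmf (\<lambda>n. (Y n, T n)) N)"
proof -
  define J where "J = map_pmf (\<lambda>n. (Y n, T n)) N"
  define g where "g z = pmf (map_pmf Y N) (fst z) * q (fst z) (snd z)" for z
  have J: "map_pmf fst J = map_pmf Y N" "map_pmf snd J = map_pmf T N"
    by (simp_all add: J_def map_pmf_comp)
  have iT: "integrable (measure_pmf N) (\<lambda>n. log 2 (pmf (map_pmf T N) (T n)))"
    using fin by (simp add: finite_ent_iff_integrable)
  have iJ: "integrable (measure_pmf N) (\<lambda>n. pmi J (Y n, T n))"
    using integrable_pmi[of J] fin by (simp add: J) (simp add: J_def)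
  have "measure_pmf.expectation N (\<lambda>n. l n - log 2 (pmf (map_pmf T N) (T n)) - pmi J (Y n, T n)) \<le> 0"
  proof (rule gibbs_inequality_map[where h = "\<lambda>n. (Y n, T n)"])
    show "0 \<le> g z" for z by (simp add: g_def q)
    have "(\<integral>\<^sup>+z. ennreal (g z) \<partial>count_space UNIV)
        = (\<integral>\<^sup>+y. \<integral>\<^sup>+t. ennreal (g (y, t)) \<partial>count_space UNIV \<partial>count_space UNIV)"
      by (rule nn_integral_fst_count_space[symmetric])
    also have "\<dots> = (\<integral>\<^sup>+y. (\<integral>\<^sup>+t. ennreal (q y t) \<partial>count_space UNIV) \<partial>measure_pmf (map_pmf Y N))"
      unfolding nn_integral_measure_pmf g_def
      by (intro nn_integral_cong) (simp add: ennreal_mult' nn_integral_cmult q)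
    finally show "(\<integral>\<^sup>+z. ennreal (g z) \<partial>count_space UNIV) \<le> 1" using sub by simp
    fix n assume n: "n \<in> set_pmf N"
    then have z: "(Y n, T n) \<in> set_pmf J" by (auto simp: J_def)
    have p: "0 < pmf (map_pmf Y N) (Y n)" "0 < pmf J (Y n, T n)"
      using n z by (auto simp: pmf_positive)
    then show "0 < g (Y n, T n)" by (simp add: g_def pos[OF n])
    show "l n - log 2 (pmf (map_pmf T N) (T n)) - pmi J (Y n, T n)
        \<le> log 2 (g (Y n, T n) / pmf (map_pmf (\<lambda>n. (Y n, T n)) N) (Y n, T n))"
      using le[OF n] pos[OF n] p pmi_split[OF z]
      by (simp add: g_def J_def[symmetric] J log_divide log_mult)
  qed (use l iT iJ in simp)
  then show ?thesis
    using l iT iJ by (simp add: J_def[symmetric] mut_info_eq_expectation ent_eq_expectation) (simp add: J_def)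
qed

lemma has_sum_expectation:
  fixes f :: "'a \<Rightarrow> real"
  assumes "integrable (measure_pmf p) f"
  shows "((\<lambda>x. pmf p x * f x) has_sum measure_pmf.expectation p f) UNIV"
  using assms unfolding infsum_pmf_mult[symmetric] integrable_measure_pmf_iff_summable
  by (rule has_sum_infsum)

section \<open>Time sharing\<close>

lemma pmf_bind_bernoulli_Pair:
  assumes "0 \<le> \<alpha>" "\<alpha> \<le> 1"
  shows "pmf (bind_pmf (bernoulli_pmf \<alpha>) (\<lambda>b. map_pmf (Pair b) (A b))) (b, y) = pmf (bernoulli_pmf \<alpha>) b * pmf (A b) y"
proof -
  have "pmf (map_pmf (Pair b') (A b')) (b, y) = (if b = b' then pmf (A b) y else 0)" for b'
    using pmf_map_inj'[of "Pair b" "A b" y] by (auto simp: inj_on_def pmf_eq_0_set_pmf)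
  then show ?thesis using assms by (cases b) (simp_all add: pmf_bind)
qed

lemma expectation_bind_bernoulli_Pair:
  fixes g :: "bool \<times> 'a \<Rightarrow> real"
  assumes "0 \<le> \<alpha>" "\<alpha> \<le> 1" and g: "\<And>b. integrable (measure_pmf (A b)) (\<lambda>z. g (b, z))"
  shows "measure_pmf.expectation (bind_pmf (bernoulli_pmf \<alpha>) (\<lambda>b. map_pmf (Pair b) (A b))) g
    = \<alpha> * measure_pmf.expectation (A True) (\<lambda>z. g (True, z)) + (1 - \<alpha>) * measure_pmf.expectation (A False) (\<lambda>z. g (False, z))"
proof -
  let ?N = "bind_pmf (bernoulli_pmf \<alpha>) (\<lambda>b. map_pmf (Pair b) (A b))"
  have part: "((\<lambda>z. pmf ?N z * g z) has_sum (pmf (bernoulli_pmf \<alpha>) b * measure_pmf.expectation (A b) (\<lambda>z. g (b, z))))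
      (Pair b ` UNIV)" for b
    by (subst has_sum_reindex)
      (auto simp: inj_on_def o_def pmf_bind_bernoulli_Pair assms mult.assoc
        intro!: has_sum_cmult_right has_sum_expectation[OF g])
  have "((\<lambda>z. pmf ?N z * g z) has_sum (pmf (bernoulli_pmf \<alpha>) True * measure_pmf.expectation (A True) (\<lambda>z. g (True, z))
      + pmf (bernoulli_pmf \<alpha>) False * measure_pmf.expectation (A False) (\<lambda>z. g (False, z))))
      (Pair True ` UNIV \<union> Pair False ` UNIV)"
    by (intro has_sum_Un_disjoint part) auto
  also have "Pair True ` UNIV \<union> Pair False ` UNIV = (UNIV :: (bool \<times> 'a) set)"
    by (auto simp: image_iff)
  finally show ?thesis
    using assms by (auto dest!: infsumI simp: infsum_pmf_mult)
qed

text \<open>The law R of c is the same under both values of the coin, so the coin tells nothing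
  about c, and once the coin is revealed the information density is that of the chosen law. A coin
  value of weight 0 has density 0 by the conventions on log and division, and contributes
  nothing.\<close>

lemma mut_info_mixture:
  fixes J :: "bool \<Rightarrow> ('y \<times> 'c) pmf"
  assumes \<alpha>: "0 \<le> \<alpha>" "\<alpha> \<le> 1" and R: "\<And>b. map_pmf snd (J b) = R" and fin: "finite_ent R"
  shows "mut_info (bind_pmf (bernoulli_pmf \<alpha>) (\<lambda>b. map_pmf (\<lambda>(y, c). ((b, y), c)) (J b)))
    = \<alpha> * mut_info (J True) + (1 - \<alpha>) * mut_info (J False)"
proof -
  let ?B = "bernoulli_pmf \<alpha>"
  define N where "N = bind_pmf ?B (\<lambda>b. map_pmf (Pair b) (J b))"
  define M where "M = bind_pmf ?B (\<lambda>b. map_pmf (\<lambda>(y, c). ((b, y), c)) (J b))"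
  have M: "M = map_pmf (\<lambda>(b, y, c). ((b, y), c)) N"
    by (simp add: M_def N_def map_bind_pmf map_pmf_comp case_prod_unfold)
  have "map_pmf snd M = bind_pmf ?B (\<lambda>b. map_pmf snd (J b))"
    by (simp add: M_def map_bind_pmf map_pmf_comp case_prod_unfold)
  then have snd: "map_pmf snd M = R" by (simp add: R)
  have fst: "map_pmf fst M = bind_pmf ?B (\<lambda>b. map_pmf (Pair b) (map_pmf fst (J b)))"
    by (simp add: M_def map_bind_pmf map_pmf_comp case_prod_unfold)
  have pM: "pmf M ((b, y), c) = pmf ?B b * pmf (J b) (y, c)" for b y c
    using pmf_map_inj'[of "\<lambda>(b, y, c). ((b, y), c)" N "(b, y, c)"]
    by (simp add: M N_def pmf_bind_bernoulli_Pair \<alpha> inj_on_def)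
  have pmi: "pmi M ((b, y), c) = (if pmf ?B b = 0 then 0 else pmi (J b) (y, c))" for b y c
    unfolding pmi_def by (simp add: pM fst pmf_bind_bernoulli_Pair \<alpha> snd R log_def del: pmf_bernoulli_True pmf_bernoulli_False)
  have i: "integrable (measure_pmf (J b)) (pmi (J b))" for b
    by (rule integrable_pmi) (simp add: R fin)
  have "mut_info M = measure_pmf.expectation N (\<lambda>(b, y, c). pmi M ((b, y), c))"
    unfolding mut_info_eq_expectation by (subst M) (simp add: case_prod_unfold)
  also have "\<dots> = \<alpha> * measure_pmf.expectation (J True) (\<lambda>(y, c). pmi M ((True, y), c))
      + (1 - \<alpha>) * measure_pmf.expectation (J False) (\<lambda>(y, c). pmi M ((False, y), c))"
    unfolding N_def
  proof (subst expectation_bind_bernoulli_Pair[OF \<alpha>])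
    show "integrable (measure_pmf (J b)) (\<lambda>z. case (b, z) of (b, y, c) \<Rightarrow> pmi M ((b, y), c))" for b
      using i[of b] by (cases "pmf ?B b = 0") (simp_all add: pmi case_prod_unfold)
  qed simp
  also have "\<dots> = \<alpha> * mut_info (J True) + (1 - \<alpha>) * mut_info (J False)"
    using \<alpha> by (cases "\<alpha> = 0"; cases "\<alpha> = 1") (simp_all add: pmi mut_info_eq_expectation case_prod_unfold)
  finally show ?thesis by (simp add: M_def)
qed

text \<open>The source \<omega> stays abstract so that one kernel can be compared with S, X, T, the
  pair (X,S) or a truncation of T by varying \<open>f\<close>.\<close>

definition obs :: "'o pmf \<Rightarrow> ('o \<Rightarrow> 'y pmf) \<Rightarrow> ('o \<Rightarrow> 'c) \<Rightarrow> ('y \<times> 'c) pmf" where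
  "obs P K f = bind_pmf P (\<lambda>\<omega>. map_pmf (\<lambda>y. (y, f \<omega>)) (K \<omega>))"

lemma map_snd_obs: "map_pmf snd (obs P K f) = map_pmf f P"
  by (simp add: obs_def map_bind_pmf map_pmf_comp) (simp add: map_pmf_def)

lemma map_fst_obs: "map_pmf fst (obs P K f) = bind_pmf P K"
  by (simp add: obs_def map_bind_pmf map_pmf_comp)

lemma map_obs: "map_pmf (\<lambda>(y, c). (y, h c)) (obs P K f) = obs P K (\<lambda>\<omega>. h (f \<omega>))"
  by (simp add: obs_def map_bind_pmf map_pmf_comp)

lemma obs_map_kernel: "obs P (\<lambda>\<omega>. map_pmf e (K \<omega>)) f = map_pmf (map_prod e id) (obs P K f)"
  by (simp add: obs_def map_bind_pmf map_pmf_comp map_prod_def)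

text \<open>One relabelling has to serve S, X and T at once. The conclusion is stated three times
  because an obtained kernel cannot carry a fact that is polymorphic in the type of
  \<open>f\<close>.\<close>

lemma mut_info_obs_nat:
  fixes P :: "'o pmf" and K :: "'o \<Rightarrow> 'y pmf"
  obtains K' :: "'o \<Rightarrow> nat pmf" where
    "\<And>f :: 'o \<Rightarrow> 'c. mut_info (obs P K' f) = mut_info (obs P K f)"
    "\<And>f :: 'o \<Rightarrow> 'd. mut_info (obs P K' f) = mut_info (obs P K f)"
    "\<And>f :: 'o \<Rightarrow> 'e. mut_info (obs P K' f) = mut_info (obs P K f)"
proof -
  define e where "e = to_nat_on (set_pmf (bind_pmf P K))"
  have "inj_on e (set_pmf (bind_pmf P K))"
    unfolding e_def by (rule inj_on_to_nat_on) (rule countable_set_pmf)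
  then have *: "mut_info (obs P (\<lambda>\<omega>. map_pmf e (K \<omega>)) f) = mut_info (obs P K f)" for f :: "'o \<Rightarrow> 'z"
    unfolding obs_map_kernel by (intro mut_info_map_inj) (simp_all only: map_fst_obs inj_on_id)
  show ?thesis by (rule that[of "\<lambda>\<omega>. map_pmf e (K \<omega>)"]) (rule *)+
qed

lemma obs_mixture:
  "obs P (\<lambda>\<omega>. bind_pmf B (\<lambda>b. map_pmf (Pair b) (K b \<omega>))) f
    = bind_pmf B (\<lambda>b. map_pmf (\<lambda>(y, c). ((b, y), c)) (obs P (K b) f))"
  unfolding obs_def map_bind_pmf
  by (subst bind_commute_pmf) (simp add: map_bind_pmf map_pmf_comp)

text \<open>The conditional law of the second component given the first, meaningful only for
  \<open>a\<close> in the support of the first marginal.\<close>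

definition cond_snd :: "('a \<times> 'b) pmf \<Rightarrow> 'a \<Rightarrow> 'b pmf" where
  "cond_snd J a = map_pmf snd (cond_pmf J {z. fst z = a})"

lemma bind_cond_snd: "bind_pmf (map_pmf fst J) (\<lambda>a. map_pmf (Pair a) (cond_snd J a)) = J"
proof -
  have "bind_pmf (map_pmf fst J) (\<lambda>a. map_pmf (Pair a) (cond_snd J a))
      = bind_pmf (map_pmf fst J) (\<lambda>a. cond_pmf J {z. a = fst z})"
  proof (intro bind_pmf_cong refl)
    fix a assume "a \<in> set_pmf (map_pmf fst J)"
    then have ne: "set_pmf J \<inter> {z. fst z = a} \<noteq> {}" by auto
    have "map_pmf (Pair a) (cond_snd J a) = map_pmf id (cond_pmf J {z. fst z = a})"
      unfolding cond_snd_def map_pmf_comp by (intro map_pmf_cong) (auto simp: set_cond_pmf[OF ne])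
    also have "{z. fst z = a} = {z. a = fst z}" by auto
    finally show "map_pmf (Pair a) (cond_snd J a) = cond_pmf J {z. a = fst z}" by simp
  qed
  also have "\<dots> = J"
    by (rule bind_cond_pmf_cancel) (auto intro!: arg_cong[where f = "measure_pmf.prob _"] simp: vimage_def)
  finally show ?thesis .
qed

lemma pmf_cond_snd:
  assumes "a \<in> set_pmf (map_pmf fst J)"
  shows "pmf (cond_snd J a) b = pmf J (a, b) / pmf (map_pmf fst J) a"
proof -
  from assms have ne: "set_pmf J \<inter> {z. fst z = a} \<noteq> {}" by auto
  have "pmf (cond_snd J a) b = pmf (map_pmf (Pair a) (cond_snd J a)) (a, b)"
    by (rule pmf_map_inj'[symmetric]) (simp add: inj_on_def)
  also have "map_pmf (Pair a) (cond_snd J a) = map_pmf id (cond_pmf J {z. fst z = a})"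
    unfolding cond_snd_def map_pmf_comp by (intro map_pmf_cong) (auto simp: set_cond_pmf[OF ne])
  also have "pmf (map_pmf id (cond_pmf J {z. fst z = a})) (a, b) = pmf J (a, b) / measure_pmf.prob J {z. fst z = a}"
    by (simp add: pmf_cond[OF ne])
  also have "{z. fst z = a} = fst -` {a}" by auto
  finally show ?thesis by (simp add: pmf_map)
qed

text \<open>Drawing T from its conditional law given W = w and then Y from the kernel yields \<nu>
  for every w, so W has no influence on Y.\<close>

lemma obs_indep:
  fixes P :: "'o pmf" and W :: "'o \<Rightarrow> 'w" and T :: "'o \<Rightarrow> 't"
  defines "J \<equiv> map_pmf (\<lambda>\<omega>. (W \<omega>, T \<omega>)) P"
  assumes \<nu>: "\<And>w. w \<in> set_pmf (map_pmf W P) \<Longrightarrow> bind_pmf (cond_snd J w) (\<kappa> w) = \<nu>"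
  shows "obs P (\<lambda>\<omega>. \<kappa> (W \<omega>) (T \<omega>)) W = pair_pmf \<nu> (map_pmf W P)"
proof -
  have fst: "map_pmf fst J = map_pmf W P" by (simp add: J_def map_pmf_comp)
  have "obs P (\<lambda>\<omega>. \<kappa> (W \<omega>) (T \<omega>)) W = bind_pmf J (\<lambda>(w, t). map_pmf (\<lambda>y. (y, w)) (\<kappa> w t))"
    by (simp add: obs_def J_def bind_map_pmf)
  also have "\<dots> = bind_pmf (map_pmf W P) (\<lambda>w. bind_pmf (cond_snd J w) (\<lambda>t. map_pmf (\<lambda>y. (y, w)) (\<kappa> w t)))"
    by (subst bind_cond_snd[symmetric]) (simp add: bind_assoc_pmf bind_map_pmf fst)
  also have "\<dots> = bind_pmf (map_pmf W P) (\<lambda>w. map_pmf (\<lambda>y. (y, w)) \<nu>)"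
    by (intro bind_pmf_cong refl) (simp add: \<nu>[symmetric] map_bind_pmf)
  also have "\<dots> = pair_pmf \<nu> (map_pmf W P)"
    by (simp add: pair_pmf_def map_pmf_def) (rule bind_commute_pmf)
  finally show ?thesis .
qed

section \<open>Functional representations\<close>

text \<open>The representation is an independent family of copies of \<open>T\<close> given \<open>W = w\<close>, for \<open>w \<in> F\<close>, whose
  component at the actual \<open>W\<close> is \<open>T\<close>.  A decoder who knows the family and guesses \<open>W\<close> according to its law
  guesses \<open>T\<close> with probability at least \<open>P(W)\<close>.\<close>

lemma functional_representation:
  fixes P :: "'o pmf" and W :: "'o \<Rightarrow> 'w" and T :: "'o \<Rightarrow> 't"
  defines "J \<equiv> map_pmf (\<lambda>\<omega>. (W \<omega>, T \<omega>)) P"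
  assumes W: "finite_ent (map_pmf W P)" and T: "finite_ent (map_pmf T P)" and F: "finite F"
  obtains K :: "'o \<Rightarrow> ('w \<Rightarrow> 't) pmf" and \<nu> where
    "obs P K W = pair_pmf \<nu> (map_pmf W P)"
    "ent (map_pmf T P) - ent (map_pmf W P)
      + measure_pmf.expectation J (\<lambda>z. if fst z \<in> F then 0 else log 2 (pmf J z)) \<le> mut_info (obs P K T)"
proof -
  define \<nu> where "\<nu> = Pi_pmf F undefined (cond_snd J)"
  \<comment> \<open>Overwriting coordinate w of the product law by a fresh draw from its own factor
    leaves the product law unchanged. Outside F the family is drawn without regard to T.\<close>
  define \<kappa> where "\<kappa> w t = (if w \<in> F then map_pmf (\<lambda>f. f(w := t)) \<nu> else \<nu>)" for w t
  define K where "K \<omega> = \<kappa> (W \<omega>) (T \<omega>)" for \<omega>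
  have "bind_pmf (cond_snd J w) (\<kappa> w) = \<nu>" for w
  proof (cases "w \<in> F")
    case False
    then show ?thesis by (simp add: \<kappa>_def[abs_def])
  next
    case True
    then have "\<nu> = Pi_pmf (insert w (F - {w})) undefined (cond_snd J)"
      by (simp add: \<nu>_def insert_absorb)
    also have "\<dots> = bind_pmf (cond_snd J w) (\<lambda>t. map_pmf (\<lambda>f. f(w := t)) (Pi_pmf (F - {w}) undefined (cond_snd J)))"
      using F by (subst Pi_pmf_insert') (auto simp: map_pmf_def)
    finally have \<nu>: "\<nu> = bind_pmf (cond_snd J w) (\<lambda>t. map_pmf (\<lambda>f. f(w := t)) (Pi_pmf (F - {w}) undefined (cond_snd J)))" .
    have "bind_pmf (cond_snd J w) (\<kappa> w)
        = bind_pmf (cond_snd J w) (\<lambda>t. map_pmf (\<lambda>f. f(w := t)) (Pi_pmf (F - {w}) undefined (cond_snd J)))"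
      using True by (simp add: \<kappa>_def[abs_def]) (subst \<nu>, simp add: map_bind_pmf map_pmf_comp)
    with \<nu> show ?thesis by simp
  qed
  then have indep: "obs P K W = pair_pmf \<nu> (map_pmf W P)"
    unfolding K_def J_def by (rule obs_indep)
  define N where "N = obs P K (\<lambda>\<omega>. \<omega>)"
  have NT: "map_pmf (\<lambda>n. (fst n, T (snd n))) N = obs P K T"
    using map_obs[of T P K "\<lambda>\<omega>. \<omega>"] by (simp add: N_def case_prod_unfold)
  have N_snd: "map_pmf snd N = P" by (simp add: N_def map_snd_obs)
  have NTs: "map_pmf (\<lambda>n. T (snd n)) N = map_pmf T P"
    by (subst N_snd[symmetric]) (simp add: map_pmf_comp)
  \<comment> \<open>The belief is the law of a guess: draw (w,t) from J, answer y(w) if w lies in F,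
    and t otherwise. The truth then has probability at least P(W) on F and at least J(W,T) off
    F.\<close>
  define q where "q y t = pmf (map_pmf (\<lambda>(w, t). if w \<in> F then y w else t) J) t" for y t
  \<comment> \<open>Keeping log P(W) off F as well only lowers the bound, and makes its mean split
    into - H(W) and the tail term.\<close>
  define h where "h \<omega> = log 2 (pmf (map_pmf W P) (W \<omega>)) + (if W \<omega> \<in> F then 0 else log 2 (pmf J (W \<omega>, T \<omega>)))" for \<omega>
  have J: "map_pmf fst J = map_pmf W P" "map_pmf snd J = map_pmf T P"
    by (simp_all add: J_def map_pmf_comp)
  have fJ: "finite_ent J" by (rule finite_ent_pair) (simp_all add: J W T)
  have tail: "integrable (measure_pmf J) (\<lambda>z. if fst z \<in> F then 0 else log 2 (pmf J z))"
  proof (rule Bochner_Integration.integrable_bound)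
    show "integrable (measure_pmf J) (\<lambda>z. log 2 (pmf J z))"
      using fJ by (simp add: finite_ent_iff_integrable)
  qed auto
  have EJ: "integrable (measure_pmf J) g \<longleftrightarrow> integrable (measure_pmf P) (\<lambda>\<omega>. g (W \<omega>, T \<omega>))"
    "measure_pmf.expectation J g = measure_pmf.expectation P (\<lambda>\<omega>. g (W \<omega>, T \<omega>))" for g :: "_ \<Rightarrow> real"
    by (simp_all add: J_def)
  have iW: "integrable (measure_pmf P) (\<lambda>\<omega>. log 2 (pmf (map_pmf W P) (W \<omega>)))"
    using W by (simp add: finite_ent_iff_integrable)
  have iT: "integrable (measure_pmf P) (\<lambda>\<omega>. if W \<omega> \<in> F then 0 else log 2 (pmf J (W \<omega>, T \<omega>)))"
    using tail unfolding EJ by simp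
  have "ent (map_pmf (\<lambda>n. T (snd n)) N) + measure_pmf.expectation N (\<lambda>n. h (snd n))
      \<le> mut_info (map_pmf (\<lambda>n. (fst n, T (snd n))) N)"
  proof (rule mut_info_ge_belief)
    show "finite_ent (map_pmf (\<lambda>n. T (snd n)) N)" by (simp add: NTs T)
    show "0 \<le> q y t" for y t by (simp add: q_def)
    show "(\<integral>\<^sup>+y. (\<integral>\<^sup>+t. ennreal (q y t) \<partial>count_space UNIV) \<partial>measure_pmf (map_pmf fst N)) \<le> 1"
      by (simp add: q_def nn_integral_pmf_UNIV)
    have "integrable (measure_pmf (map_pmf snd N)) h"
      unfolding N_snd h_def using iW iT by simp
    then show "integrable (measure_pmf N) (\<lambda>n. h (snd n))" by simp
    fix n assume "n \<in> set_pmf N"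
    then obtain y \<omega> where n: "n = (y, \<omega>)" "\<omega> \<in> set_pmf P" "y \<in> set_pmf (K \<omega>)"
      by (auto simp: N_def obs_def)
    have WT: "(W \<omega>, T \<omega>) \<in> set_pmf J" using n by (auto simp: J_def)
    have posJ: "0 < pmf J (W \<omega>, T \<omega>)" "0 < pmf (map_pmf W P) (W \<omega>)"
      using WT n by (auto intro!: pmf_positive)
    have "0 < q y (T \<omega>) \<and> h \<omega> \<le> log 2 (q y (T \<omega>))"
    proof (cases "W \<omega> \<in> F")
      case True
      with n have y: "y (W \<omega>) = T \<omega>" by (auto simp: K_def \<kappa>_def)
      have "pmf (map_pmf fst J) (W \<omega>) \<le> q y (T \<omega>)"
        unfolding q_def pmf_map by (rule measure_pmf.finite_measure_mono) (use True y in auto)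
      then show ?thesis using posJ True by (auto simp: J h_def)
    next
      case False
      have "pmf J (W \<omega>, T \<omega>) \<le> q y (T \<omega>)"
        using pmf_map_ge[of J "(W \<omega>, T \<omega>)" "\<lambda>(w, t). if w \<in> F then y w else t"] False by (simp add: q_def)
      then have "0 < q y (T \<omega>) \<and> log 2 (pmf J (W \<omega>, T \<omega>)) \<le> log 2 (q y (T \<omega>))"
        using posJ by auto
      then show ?thesis using False log2_pmf_nonpos[of "map_pmf W P" "W \<omega>"] by (auto simp: h_def)
    qed
    then show "0 < q (fst n) (T (snd n))" "h (snd n) \<le> log 2 (q (fst n) (T (snd n)))"
      by (simp_all add: n)
  qed
  also have "measure_pmf.expectation N (\<lambda>n. h (snd n)) = measure_pmf.expectation P h"
    by (subst N_snd[symmetric]) simp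
  also have "\<dots> = - ent (map_pmf W P) + measure_pmf.expectation J (\<lambda>z. if fst z \<in> F then 0 else log 2 (pmf J z))"
    unfolding h_def using iW iT by (simp add: ent_eq_expectation EJ)
  finally show ?thesis using that[OF indep] by (simp add: NT NTs)
qed

text \<open>F collects the first coordinates of a finite set G that carries almost all of the
  entropy. A pair whose first coordinate avoids F lies outside G, and all terms have the same
  sign.\<close>

lemma finite_ent_tail:
  fixes J :: "('w \<times> 't) pmf"
  assumes fin: "finite_ent J" and "0 < \<epsilon>"
  obtains F where "finite F"
    "- \<epsilon> \<le> measure_pmf.expectation J (\<lambda>z. if fst z \<in> F then 0 else log 2 (pmf J z))"
proof -
  let ?f = "\<lambda>z. pmf J z * log 2 (pmf J z)"
  have i: "integrable (measure_pmf J) (\<lambda>z. log 2 (pmf J z))"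
    using fin by (simp add: finite_ent_iff_integrable)
  obtain G where G: "finite G" "dist (sum ?f G) (measure_pmf.expectation J (\<lambda>z. log 2 (pmf J z))) \<le> \<epsilon>"
    using has_sum_finite_approximation[OF has_sum_expectation[OF i] \<open>0 < \<epsilon>\<close>] by auto
  have "((\<lambda>z. if z \<in> G then - ?f z else 0) has_sum - sum ?f G) UNIV"
    by (rule has_sum_finite_neutralI[of G]) (use G in \<open>auto simp: sum_negf\<close>)
  from has_sum_add[OF has_sum_expectation[OF i] this]
  have d: "((\<lambda>z. ?f z + (if z \<in> G then - ?f z else 0)) has_sum
      (measure_pmf.expectation J (\<lambda>z. log 2 (pmf J z)) - sum ?f G)) UNIV" by simp
  have t: "integrable (measure_pmf J) (\<lambda>z. if fst z \<in> fst ` G then 0 else log 2 (pmf J z))"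
    by (rule Bochner_Integration.integrable_bound[OF i]) auto
  have "measure_pmf.expectation J (\<lambda>z. log 2 (pmf J z)) - sum ?f G
      \<le> measure_pmf.expectation J (\<lambda>z. if fst z \<in> fst ` G then 0 else log 2 (pmf J z))"
    by (rule has_sum_mono[OF d has_sum_expectation[OF t]])
      (auto simp: mult_nonneg_nonpos log2_pmf_nonpos)
  moreover have "- \<epsilon> \<le> measure_pmf.expectation J (\<lambda>z. log 2 (pmf J z)) - sum ?f G"
    using G(2) by (simp add: dist_real_def)
  ultimately show ?thesis using that[of "fst ` G"] G(1) by simp
qed

section \<open>The exponential race\<close>

definition law :: "'a measure \<Rightarrow> ('a \<Rightarrow> 'b::countable) \<Rightarrow> 'b pmf" where
  "law M f = Abs_pmf (distr M (count_space UNIV) f)"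

lemma measure_pmf_law:
  fixes f :: "'a \<Rightarrow> 'b::countable"
  assumes "prob_space M" and f: "f \<in> measurable M (count_space UNIV)"
  shows "measure_pmf (law M f) = distr M (count_space UNIV) f"
  unfolding law_def
proof (rule Abs_pmf_inverse, intro CollectI conjI)
  interpret M: prob_space M by fact
  show D: "prob_space (distr M (count_space UNIV) f)" by (rule M.prob_space_distr[OF f])
  interpret D: prob_space "distr M (count_space UNIV) f" by fact
  show "AE x in distr M (count_space UNIV) f. measure (distr M (count_space UNIV) f) {x} \<noteq> 0"
    by (subst D.AE_support_countable) (auto intro!: exI[of _ UNIV])
qed simp

section \<open>Integrals against exponential laws\<close>

abbreviation exp1 :: "real measure" where
  "exp1 \<equiv> density lborel (exponential_density 1)"

lemma prob_space_exp1: "prob_space exp1"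
  by (rule prob_space_exponential_density) simp

lemma AE_exp1_nonneg: "AE x in exp1. 0 \<le> x"
  by (auto simp: AE_density exponential_density_def)

lemma nn_integral_exp1:
  assumes [measurable]: "f \<in> borel_measurable borel"
  shows "(\<integral>\<^sup>+x. f x \<partial>exp1) = (\<integral>\<^sup>+x. f x * ennreal (exp (- x)) * indicator {0..} x \<partial>lborel)"
  by (subst nn_integral_density)
    (auto intro!: nn_integral_cong simp: exponential_density_def mult.commute split: split_indicator)

lemma emeasure_exp1_greaterThan:
  assumes "0 \<le> a"
  shows "emeasure exp1 {a<..} = ennreal (exp (- a))"
proof -
  interpret prob_space exp1 by (rule prob_space_exp1)
  have "distributed exp1 lborel (\<lambda>x. x) (exponential_density 1)"
    by (auto simp: distributed_def distr_id2)
  from exponential_distributedD_gt[OF this assms]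
  show ?thesis by (simp add: emeasure_eq_measure greaterThan_def)
qed

lemma nn_integral_exp_decay:
  fixes l :: real
  assumes "0 < l" "0 \<le> c"
  shows "(\<integral>\<^sup>+x. ennreal ((x + c) * exp (- x * l)) * indicator {0..} x \<partial>lborel) = ennreal (1 / l^2 + c / l)"
    and "(\<integral>\<^sup>+x. ennreal (exp (- x * l)) * indicator {0..} x \<partial>lborel) = ennreal (1 / l)"
proof -
  have *: "(\<integral>\<^sup>+x. ennreal (x ^ i * exp (- x * l)) * indicator {0..} x \<partial>lborel) = ennreal (fact i / l ^ (i + 1))" for i :: nat
  proof -
    have "(\<integral>\<^sup>+x. ennreal (x ^ i * exp (- x * l)) * indicator {0..} x \<partial>lborel)
        = (\<integral>\<^sup>+x. ennreal (1 / l) * ennreal (exponential_density l x * x ^ i) \<partial>lborel)"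
      using assms by (intro nn_integral_cong)
        (auto simp: exponential_density_def ennreal_mult'[symmetric] mult_ac split: split_indicator)
    also have "\<dots> = ennreal (1 / l) * ennreal (fact i / l ^ i)"
      using nn_integral_erlang_ith_moment[OF assms(1), of 0 i] by (subst nn_integral_cmult) simp_all
    finally show ?thesis using assms by (simp add: ennreal_mult'[symmetric])
  qed
  show 0: "(\<integral>\<^sup>+x. ennreal (exp (- x * l)) * indicator {0..} x \<partial>lborel) = ennreal (1 / l)"
    using *[of 0] by simp
  have "(\<integral>\<^sup>+x. ennreal ((x + c) * exp (- x * l)) * indicator {0..} x \<partial>lborel)
      = (\<integral>\<^sup>+x. ennreal (x ^ 1 * exp (- x * l)) * indicator {0..} x + ennreal c * (ennreal (exp (- x * l)) * indicator {0..} x) \<partial>lborel)"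
    using assms by (intro nn_integral_cong)
      (auto simp: ennreal_mult'[symmetric] ennreal_plus[symmetric] distrib_right simp del: ennreal_plus split: split_indicator)
  also have "\<dots> = ennreal (1 / l^2) + ennreal c * ennreal (1 / l)"
    by (subst nn_integral_add, simp, simp, subst nn_integral_cmult, simp) (simp only: * 0, simp add: power2_eq_square)
  finally show "(\<integral>\<^sup>+x. ennreal ((x + c) * exp (- x * l)) * indicator {0..} x \<partial>lborel) = ennreal (1 / l^2 + c / l)"
    using assms by (simp add: ennreal_mult'[symmetric] ennreal_plus[symmetric] del: ennreal_plus)
qed

text \<open>The antiderivative is - (p / \<epsilon>) (x / p + b) powr (- \<epsilon>). The value is
  linear in p, so with p = P(t) the decoder's weights sum to one common constant.\<close>

lemma nn_integral_shifted_power: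
  fixes b p \<epsilon> :: real
  assumes b: "0 < b" and p: "0 < p" and \<epsilon>: "0 < \<epsilon>"
  shows "(\<integral>\<^sup>+x. ennreal ((x / p + b) powr (- \<epsilon> - 1)) * indicator {0..} x \<partial>lborel) = ennreal (p * b powr (- \<epsilon>) / \<epsilon>)"
proof -
  let ?F = "\<lambda>x. - (p / \<epsilon>) * (x / p + b) powr (- \<epsilon>)"
  have pos: "0 < x / p + b" if "0 \<le> x" for x using that b p by (simp add: add_nonneg_pos)
  have "(\<integral>\<^sup>+x. ennreal ((x / p + b) powr (- \<epsilon> - 1)) * indicator {0..} x \<partial>lborel) = ennreal (0 - ?F 0)"
  proof (rule nn_integral_FTC_atLeast)
    show "DERIV ?F x :> (x / p + b) powr (- \<epsilon> - 1)" if "0 \<le> x" for x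
      using pos[OF that] p \<epsilon>
      by (auto intro!: derivative_eq_intros simp: field_simps)
    have "filterlim (\<lambda>x. x / p + b) at_top at_top"
      using p by real_asymp
    then have "((\<lambda>x. (x / p + b) powr (- \<epsilon>)) \<longlongrightarrow> 0) at_top"
      using \<epsilon> by (intro tendsto_neg_powr) auto
    then have "((\<lambda>x. - (p / \<epsilon>) * (x / p + b) powr (- \<epsilon>)) \<longlongrightarrow> - (p / \<epsilon>) * 0) at_top"
      by (intro tendsto_mult tendsto_const)
    then show "(?F \<longlongrightarrow> 0) at_top" by simp
  qed auto
  then show ?thesis by simp
qed

locale exp_race =
  fixes I :: "'u set"
  assumes finite_I: "finite I"
begin

definition clocks :: "('u \<Rightarrow> real) measure" where
  "clocks = PiM I (\<lambda>_. exp1)"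

text \<open>The comparison of e(t) / q(t) is cross-multiplied, so that a competitor of weight 0
  loses as soon as its clock is positive. Ties belong to nobody.\<close>

definition wins :: "'u pmf \<Rightarrow> 'u \<Rightarrow> ('u \<Rightarrow> real) set" where
  "wins q t = {e \<in> space clocks. \<forall>t'\<in>I - {t}. e t * pmf q t' < e t' * pmf q t}"

sublocale PS: product_prob_space "\<lambda>_. exp1" I
  by (simp add: product_prob_space_def product_sigma_finite_def product_prob_space_axioms_def
      prob_space_exp1 prob_space_imp_sigma_finite)

lemma prob_space_clocks: "prob_space clocks"
  unfolding clocks_def by (intro prob_space_PiM prob_space_exp1)

lemma sets_clocks[measurable_cong]: "sets clocks = sets (PiM I (\<lambda>_. borel))"
  unfolding clocks_def by (intro sets_PiM_cong) auto

lemma space_clocks: "space clocks = Pi\<^sub>E I (\<lambda>_. UNIV)"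
  by (simp add: clocks_def space_PiM)

lemma measurable_clock: "t \<in> I \<Longrightarrow> (\<lambda>e. e t) \<in> borel_measurable clocks"
  unfolding measurable_cong_sets[OF sets_clocks refl] by (rule measurable_component_singleton)

lemma sets_wins:
  assumes "t \<in> I"
  shows "wins q t \<in> sets clocks"
  unfolding wins_def
proof (rule sets.sets_Collect_finite_All)
  fix t' assume "t' \<in> I - {t}"
  then have [measurable]: "(\<lambda>e. e t) \<in> borel_measurable clocks" "(\<lambda>e. e t') \<in> borel_measurable clocks"
    using assms by (auto intro: measurable_clock)
  show "{e \<in> space clocks. e t * pmf q t' < e t' * pmf q t} \<in> sets clocks" by measurable
qed (use finite_I in simp)

lemma wins_disjoint:
  assumes "t \<in> I" "t' \<in> I" "t \<noteq> t'"
  shows "wins q t \<inter> wins q t' = {}"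
proof (rule ccontr)
  assume "wins q t \<inter> wins q t' \<noteq> {}"
  then obtain e where "e \<in> wins q t" "e \<in> wins q t'" by auto
  then have "e t * pmf q t' < e t' * pmf q t" "e t' * pmf q t < e t * pmf q t'"
    using assms by (auto simp: wins_def)
  then show False by simp
qed

text \<open>On the event that \<open>t\<close> wins, its clock \<open>x\<close> has density \<open>exp (- x / q(t))\<close>: the other clocks must exceed
  \<open>x q(t') / q(t)\<close>, and these thresholds add up to \<open>x (1 - q(t)) / q(t)\<close>.\<close>

lemma nn_integral_wins:
  assumes q: "set_pmf q \<subseteq> I" and t: "t \<in> set_pmf q" and h[measurable]: "h \<in> borel_measurable borel"
  shows "(\<integral>\<^sup>+e. h (e t) * indicator (wins q t) e \<partial>clocks)
    = (\<integral>\<^sup>+x. h x * ennreal (exp (- x * (1 / pmf q t))) * indicator {0..} x \<partial>lborel)"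
proof -
  define I' where "I' = I - {t}"
  have tI: "t \<in> I" using q t by auto
  have I: "I = insert t I'" "finite I'" "t \<notin> I'" using tI finite_I by (auto simp: I'_def)
  have qt: "0 < pmf q t" using t by (rule pmf_positive)
  have [measurable]: "wins q t \<in> sets (PiM (insert t I') (\<lambda>_. exp1))"
    using sets_wins[OF tI] unfolding clocks_def I(1)[symmetric] .
  have "(\<Sum>s\<in>I. pmf q s) = 1" using finite_I q by (rule sum_pmf_eq_1)
  then have sumq: "(\<Sum>s\<in>I'. pmf q s) = 1 - pmf q t"
    using I by simp
  have inner: "(\<integral>\<^sup>+e. h ((e(t := x)) t) * indicator (wins q t) (e(t := x)) \<partial>PiM I' (\<lambda>_. exp1))
      = h x * ennreal (exp (- x * ((1 - pmf q t) / pmf q t)))" if x: "0 \<le> x" for x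
  proof -
    define B where "B = Pi\<^sub>E I' (\<lambda>s. {x * pmf q s / pmf q t <..})"
    have B: "B \<in> sets (PiM I' (\<lambda>_. exp1))"
      unfolding B_def using I(2) by (intro sets_PiM_I_finite) auto
    have "(\<integral>\<^sup>+e. h ((e(t := x)) t) * indicator (wins q t) (e(t := x)) \<partial>PiM I' (\<lambda>_. exp1))
        = (\<integral>\<^sup>+e. h x * indicator B e \<partial>PiM I' (\<lambda>_. exp1))"
    proof (intro nn_integral_cong)
      fix e assume e: "e \<in> space (PiM I' (\<lambda>_. exp1))"
      have "e(t := x) \<in> wins q t \<longleftrightarrow> e \<in> B"
      proof -
        have "e(t := x) \<in> space clocks"
          using e tI by (auto simp: space_clocks space_PiM PiE_def extensional_def I'_def)
        then show ?thesis
          using e qt I(3) unfolding wins_def B_def I'_def[symmetric]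
          by (auto simp: space_PiM PiE_iff pos_divide_less_eq)
      qed
      then show "h ((e(t := x)) t) * indicator (wins q t) (e(t := x)) = h x * indicator B e"
        by (simp add: indicator_def)
    qed
    also have "\<dots> = h x * emeasure (PiM I' (\<lambda>_. exp1)) B"
      using B by (rule nn_integral_cmult_indicator)
    also have "emeasure (PiM I' (\<lambda>_. exp1)) B = (\<Prod>s\<in>I'. emeasure exp1 {x * pmf q s / pmf q t <..})"
      unfolding B_def by (rule PS.emeasure_PiM) (use I in auto)
    also have "\<dots> = (\<Prod>s\<in>I'. ennreal (exp (- (x * pmf q s / pmf q t))))"
      using x qt by (intro prod.cong refl emeasure_exp1_greaterThan) simp
    also have "\<dots> = ennreal (exp (- x * ((1 - pmf q t) / pmf q t)))"
    proof -
      have "(\<Sum>s\<in>I'. - (x * pmf q s / pmf q t)) = - x * ((1 - pmf q t) / pmf q t)"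
        unfolding sumq[symmetric]
        by (simp add: sum_negf sum_divide_distrib sum_distrib_left)
      then show ?thesis
        using I(2) by (simp add: prod_ennreal exp_sum[symmetric])
    qed
    finally show ?thesis .
  qed
  have "(\<lambda>e. h (e t) * indicator (wins q t) e) \<in> borel_measurable clocks"
    using measurable_clock[OF tI] sets_wins[OF tI] by measurable
  then have "(\<lambda>e. h (e t) * indicator (wins q t) e) \<in> borel_measurable (PiM (insert t I') (\<lambda>_. exp1))"
    unfolding I(1)[symmetric] clocks_def .
  from PS.product_nn_integral_insert_rev[OF I(2,3) this]
  have "(\<integral>\<^sup>+e. h (e t) * indicator (wins q t) e \<partial>clocks)
      = (\<integral>\<^sup>+x. (\<integral>\<^sup>+e. h ((e(t := x)) t) * indicator (wins q t) (e(t := x)) \<partial>PiM I' (\<lambda>_. exp1)) \<partial>exp1)"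
    unfolding I(1)[symmetric] clocks_def[symmetric] .
  also have "\<dots> = (\<integral>\<^sup>+x. h x * ennreal (exp (- x * ((1 - pmf q t) / pmf q t))) \<partial>exp1)"
    using AE_exp1_nonneg by (intro nn_integral_cong_AE) (auto elim!: eventually_mono simp only: inner)
  also have "\<dots> = (\<integral>\<^sup>+x. h x * ennreal (exp (- x * ((1 - pmf q t) / pmf q t))) * ennreal (exp (- x)) * indicator {0..} x \<partial>lborel)"
    by (rule nn_integral_exp1) measurable
  also have "\<dots> = (\<integral>\<^sup>+x. h x * ennreal (exp (- x * (1 / pmf q t))) * indicator {0..} x \<partial>lborel)"
  proof (intro nn_integral_cong)
    fix x
    have "- x * ((1 - pmf q t) / pmf q t) + - x = - x * (1 / pmf q t)"
      using qt by (simp add: field_simps)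
    then have "ennreal (exp (- x * ((1 - pmf q t) / pmf q t))) * ennreal (exp (- x)) = ennreal (exp (- x * (1 / pmf q t)))"
      by (simp add: ennreal_mult'[symmetric] exp_add[symmetric] del: mult_minus_left)
    then show "h x * ennreal (exp (- x * ((1 - pmf q t) / pmf q t))) * ennreal (exp (- x)) * indicator {0..} x
        = h x * ennreal (exp (- x * (1 / pmf q t))) * indicator {0..} x"
      by (simp add: mult.assoc)
  qed
  finally show ?thesis .
qed

lemma emeasure_wins:
  assumes "set_pmf q \<subseteq> I" "t \<in> set_pmf q"
  shows "emeasure clocks (wins q t) = ennreal (pmf q t)"
proof -
  have "emeasure clocks (wins q t) = (\<integral>\<^sup>+e. 1 * indicator (wins q t) e \<partial>clocks)"
    using sets_wins[of t q] assms by auto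
  also have "\<dots> = ennreal (pmf q t)"
    using nn_integral_wins[OF assms, of "\<lambda>_. 1"] nn_integral_exp_decay(2)[of "1 / pmf q t" 0] pmf_positive[OF assms(2)]
    by simp
  finally show ?thesis .
qed

end

text \<open>A discrete interface to the race: \<nu> is the law of the rounded clocks,
  \<open>\<Theta>\<close> reads off one of them, and \<kappa> t is the law of the clocks given that
  t wins. Only \<kappa> depends on q, which is what makes the representation independent of the
  conditioning variable. Given a win of t, its clock is exponential with mean q(t); \<delta> pays
  for the rounding.\<close>

lemma exponential_race:
  fixes I :: "'u set"
  assumes I: "finite I" and \<delta>: "0 < \<delta>"
  obtains \<nu> :: "nat list pmf" and \<Theta> :: "'u \<Rightarrow> nat list \<Rightarrow> real" where
    "\<And>t y. 0 \<le> \<Theta> t y"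
    "\<And>t p b \<epsilon>. t \<in> I \<Longrightarrow> 0 < p \<Longrightarrow> 0 < b \<Longrightarrow> 0 < \<epsilon> \<Longrightarrow>
      (\<integral>\<^sup>+y. ennreal ((\<Theta> t y / p + b) powr (- \<epsilon> - 1)) \<partial>measure_pmf \<nu>) \<le> ennreal (p * b powr (- \<epsilon>) / \<epsilon>)"
    "\<And>q. set_pmf q \<subseteq> I \<Longrightarrow> \<exists>\<kappa>. bind_pmf q \<kappa> = \<nu> \<and>
      (\<forall>t\<in>set_pmf q. (\<integral>\<^sup>+y. ennreal (\<Theta> t y) \<partial>measure_pmf (\<kappa> t)) \<le> ennreal (pmf q t + \<delta>))"
proof -
  interpret exp_race I by standard (rule I)
  interpret C: prob_space clocks by (rule prob_space_clocks)
  obtain n :: nat where n: "0 < n" "1 / real n < \<delta>"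
    using ex_inverse_of_nat_less[OF \<delta>] by (auto simp: inverse_eq_divide)
  obtain ts where ts: "set ts = I" using finite_list[OF I] by blast
  then have "\<forall>t\<in>I. \<exists>i. i < length ts \<and> ts ! i = t" by (auto simp: in_set_conv_nth)
  then obtain idx where idx: "\<And>t. t \<in> I \<Longrightarrow> idx t < length ts \<and> ts ! idx t = t" by metis
  \<comment> \<open>Rounding up suits both estimates: the decreasing power only shrinks, and the
    mean grows by at most 1 / n < \<delta>. A negative clock is sent to 0 by \<open>nat\<close>,
    whence the \<open>max 0\<close> in the two bounds.\<close>
  define Y where "Y e = map (\<lambda>t. nat \<lceil>real n * e t\<rceil>) ts" for e :: "'u \<Rightarrow> real"
  define \<Theta> where "\<Theta> t y = real (y ! idx t) / real n" for t y
  have \<Theta>Y: "\<Theta> t (Y e) = real (nat \<lceil>real n * e t\<rceil>) / real n" if "t \<in> I" for t e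
    using idx[OF that] by (simp add: \<Theta>_def Y_def)
  have \<Theta>_ge: "max 0 (e t) \<le> \<Theta> t (Y e)" if "t \<in> I" for t e
  proof -
    have "real n * e t \<le> real (nat \<lceil>real n * e t\<rceil>)" by linarith
    then have "e t \<le> \<Theta> t (Y e)" using n by (simp add: \<Theta>Y that field_simps)
    moreover have "0 \<le> \<Theta> t (Y e)" by (simp add: \<Theta>_def)
    ultimately show ?thesis by simp
  qed
  have \<Theta>_le: "\<Theta> t (Y e) \<le> max 0 (e t) + \<delta>" if "t \<in> I" for t e
  proof -
    have "real (nat \<lceil>real n * e t\<rceil>) \<le> max 0 (real n * e t) + 1" by linarith
    also have "max 0 (real n * e t) = real n * max 0 (e t)" using n by (simp add: max_mult_distrib_left)
    finally have "\<Theta> t (Y e) \<le> (real n * max 0 (e t) + 1) / real n"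
      unfolding \<Theta>Y[OF that] by (rule divide_right_mono) simp
    also have "\<dots> = max 0 (e t) + 1 / real n" using n by (simp add: add_divide_distrib)
    finally show ?thesis using n by simp
  qed
  have Y: "Y \<in> measurable clocks (count_space UNIV)"
  proof (subst measurable_count_space_eq_countable, safe)
    fix ys :: "nat list"
    have "Y -` {ys} \<inter> space clocks = (if length ys = length ts
        then {e \<in> space clocks. \<forall>i\<in>{..<length ts}. nat \<lceil>real n * e (ts ! i)\<rceil> = ys ! i} else {})"
      by (auto simp: Y_def list_eq_iff_nth_eq)
    moreover have "{e \<in> space clocks. \<forall>i\<in>{..<length ts}. nat \<lceil>real n * e (ts ! i)\<rceil> = ys ! i} \<in> sets clocks"
    proof (rule sets.sets_Collect_finite_All)
      fix i assume "i \<in> {..<length ts}"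
      then have [measurable]: "(\<lambda>e. e (ts ! i)) \<in> borel_measurable clocks"
        using ts by (intro measurable_clock) auto
      show "{e \<in> space clocks. nat \<lceil>real n * e (ts ! i)\<rceil> = ys ! i} \<in> sets clocks" by measurable
    qed simp
    ultimately show "Y -` {ys} \<inter> space clocks \<in> sets clocks" by simp
  qed simp_all
  define \<nu> where "\<nu> = law clocks Y"
  have \<nu>: "measure_pmf \<nu> = distr clocks (count_space UNIV) Y"
    unfolding \<nu>_def by (rule measure_pmf_law[OF prob_space_clocks Y])
  show ?thesis
  proof (rule that)
    show "0 \<le> \<Theta> t y" for t y by (simp add: \<Theta>_def)
  next
    fix t p b \<epsilon> assume t: "t \<in> I" and p: "0 < (p::real)" and b: "0 < (b::real)" and \<epsilon>: "0 < (\<epsilon>::real)"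
    let ?f = "\<lambda>x. ennreal ((x / p + b) powr (- \<epsilon> - 1))"
    have "(\<integral>\<^sup>+y. ?f (\<Theta> t y) \<partial>measure_pmf \<nu>) = (\<integral>\<^sup>+e. ?f (\<Theta> t (Y e)) \<partial>clocks)"
      unfolding \<nu> by (rule nn_integral_distr[OF Y]) simp
    also have "\<dots> \<le> (\<integral>\<^sup>+e. ?f (max 0 (e t)) \<partial>clocks)"
    proof (intro nn_integral_mono ennreal_leI powr_mono2')
      fix e
      show "0 < max 0 (e t) / p + b" using p b by (simp add: add_nonneg_pos)
      show "max 0 (e t) / p + b \<le> \<Theta> t (Y e) / p + b"
        using \<Theta>_ge[OF t, of e] p by (intro add_right_mono divide_right_mono) auto
    qed (use \<epsilon> in simp)
    also have "\<dots> = (\<integral>\<^sup>+x. ?f (max 0 x) \<partial>distr clocks exp1 (\<lambda>e. e t))"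
      using measurable_clock[OF t] by (subst nn_integral_distr) simp_all
    also have "distr clocks exp1 (\<lambda>e. e t) = exp1"
      unfolding clocks_def by (rule PS.PiM_component[OF t])
    also have "(\<integral>\<^sup>+x. ?f (max 0 x) \<partial>exp1) = (\<integral>\<^sup>+x. ?f (max 0 x) * ennreal (exp (- x)) * indicator {0..} x \<partial>lborel)"
      by (rule nn_integral_exp1) measurable
    \<comment> \<open>The exponential density is at most 1; dropping it leaves an integral in closed
      form.\<close>
    also have "\<dots> \<le> (\<integral>\<^sup>+x. ?f x * indicator {0..} x \<partial>lborel)"
      by (intro nn_integral_mono) (auto simp: ennreal_mult'[symmetric] intro!: ennreal_leI mult_left_le split: split_indicator)
    also have "\<dots> = ennreal (p * b powr (- \<epsilon>) / \<epsilon>)"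
      by (rule nn_integral_shifted_power[OF b p \<epsilon>])
    finally show "(\<integral>\<^sup>+y. ?f (\<Theta> t y) \<partial>measure_pmf \<nu>) \<le> ennreal (p * b powr (- \<epsilon>) / \<epsilon>)" .
  next
    fix q :: "'u pmf" assume q: "set_pmf q \<subseteq> I"
    define U where "U t = uniform_measure clocks (wins q t)" for t
    define \<kappa> where "\<kappa> t = law (U t) Y" for t
    have U: "prob_space (U t)" if "t \<in> set_pmf q" for t
      unfolding U_def by (rule prob_space_uniform_measure)
        (use emeasure_wins[OF q that] pmf_positive[OF that] in auto)
    have YU: "Y \<in> measurable (U t) (count_space UNIV)" for t
      using Y unfolding U_def by (subst measurable_cong_sets[OF sets_uniform_measure refl])
    have \<kappa>: "measure_pmf (\<kappa> t) = distr (U t) (count_space UNIV) Y" if "t \<in> set_pmf q" for t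
      unfolding \<kappa>_def by (rule measure_pmf_law[OF U[OF that] YU])
    have int\<kappa>: "(\<integral>\<^sup>+y. f y \<partial>measure_pmf (\<kappa> t)) = (\<integral>\<^sup>+e. f (Y e) * indicator (wins q t) e \<partial>clocks) / ennreal (pmf q t)"
      if t: "t \<in> set_pmf q" for t and f :: "nat list \<Rightarrow> ennreal"
    proof -
      have tI: "t \<in> I" using q t by auto
      have [measurable]: "(\<lambda>e. f (Y e)) \<in> borel_measurable clocks"
        by (rule measurable_compose[OF Y]) simp
      have "(\<integral>\<^sup>+y. f y \<partial>measure_pmf (\<kappa> t)) = (\<integral>\<^sup>+e. f (Y e) \<partial>U t)"
        unfolding \<kappa>[OF t] by (rule nn_integral_distr[OF YU]) simp
      also have "\<dots> = (\<integral>\<^sup>+e. f (Y e) * indicator (wins q t) e \<partial>clocks) / emeasure clocks (wins q t)"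
        unfolding U_def by (rule nn_integral_uniform_measure) (auto intro: sets_wins[OF tI])
      finally show ?thesis by (simp add: emeasure_wins[OF q t])
    qed
    have fin: "finite (set_pmf q)" using q I finite_subset by blast
    \<comment> \<open>Disjointness of the winning events gives one inequality between the masses.
      That the events cover almost everything need not be shown, as both sides are probability
      laws.\<close>
    have "bind_pmf q \<kappa> = \<nu>"
    proof (rule pmf_eqI_le)
      fix y
      define B where "B = Y -` {y} \<inter> space clocks"
      have B[measurable]: "B \<in> sets clocks" unfolding B_def by (rule measurable_sets[OF Y]) simp
      have part: "pmf q t * pmf (\<kappa> t) y = measure clocks (B \<inter> wins q t)" if t: "t \<in> set_pmf q" for t
      proof -
        have tI: "t \<in> I" using q t by auto
        have qt: "0 < pmf q t" using t by (rule pmf_positive)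
        have "ennreal (pmf (\<kappa> t) y) = (\<integral>\<^sup>+z. indicator {y} z \<partial>measure_pmf (\<kappa> t))"
          by (simp add: emeasure_pmf_single)
        also have "\<dots> = (\<integral>\<^sup>+e. indicator {y} (Y e) * indicator (wins q t) e \<partial>clocks) / ennreal (pmf q t)"
          by (rule int\<kappa>[OF t])
        also have "(\<integral>\<^sup>+e. indicator {y} (Y e) * indicator (wins q t) e \<partial>clocks)
            = (\<integral>\<^sup>+e. indicator (B \<inter> wins q t) e \<partial>clocks)"
          by (intro nn_integral_cong) (auto simp: B_def split: split_indicator)
        also have "\<dots> = emeasure clocks (B \<inter> wins q t)"
          using sets_wins[OF tI] B by (intro nn_integral_indicator) auto
        finally have "ennreal (pmf (\<kappa> t) y) = ennreal (measure clocks (B \<inter> wins q t) / pmf q t)"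
          using qt by (simp add: C.emeasure_eq_measure divide_ennreal)
        then have "pmf (\<kappa> t) y = measure clocks (B \<inter> wins q t) / pmf q t" by (subst (asm) ennreal_inj) auto
        then show ?thesis using qt by simp
      qed
      have "pmf (bind_pmf q \<kappa>) y = (\<Sum>t\<in>set_pmf q. pmf q t * pmf (\<kappa> t) y)"
        unfolding pmf_bind by (subst integral_measure_pmf_real[OF fin]) (auto simp: mult.commute)
      also have "\<dots> = (\<Sum>t\<in>set_pmf q. measure clocks (B \<inter> wins q t))"
        by (rule sum.cong[OF refl part])
      also have "\<dots> = measure clocks (\<Union>t\<in>set_pmf q. B \<inter> wins q t)"
      proof (rule C.finite_measure_finite_Union[symmetric, OF fin])
        show "(\<lambda>t. B \<inter> wins q t) ` set_pmf q \<subseteq> sets clocks"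
          using B sets_wins q by auto
        show "disjoint_family_on (\<lambda>t. B \<inter> wins q t) (set_pmf q)"
          using wins_disjoint q by (fastforce simp: disjoint_family_on_def)
      qed
      also have "\<dots> \<le> measure clocks B" by (rule C.finite_measure_mono[OF _ B]) auto
      also have "\<dots> = pmf \<nu> y"
        unfolding pmf.rep_eq \<nu> B_def by (subst measure_distr[OF Y]) auto
      finally show "pmf (bind_pmf q \<kappa>) y \<le> pmf \<nu> y" .
    qed
    moreover have "(\<integral>\<^sup>+y. ennreal (\<Theta> t y) \<partial>measure_pmf (\<kappa> t)) \<le> ennreal (pmf q t + \<delta>)" if t: "t \<in> set_pmf q" for t
    proof -
      have tI: "t \<in> I" using q t by auto
      have qt: "0 < pmf q t" using t by (rule pmf_positive)
      have "(\<integral>\<^sup>+e. ennreal (\<Theta> t (Y e)) * indicator (wins q t) e \<partial>clocks)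
          \<le> (\<integral>\<^sup>+e. ennreal (max 0 (e t) + \<delta>) * indicator (wins q t) e \<partial>clocks)"
        by (intro nn_integral_mono mult_right_mono ennreal_leI \<Theta>_le[OF tI]) simp
      also have "\<dots> = (\<integral>\<^sup>+x. ennreal (max 0 x + \<delta>) * ennreal (exp (- x * (1 / pmf q t))) * indicator {0..} x \<partial>lborel)"
        by (rule nn_integral_wins[OF q t]) measurable
      also have "\<dots> = (\<integral>\<^sup>+x. ennreal ((x + \<delta>) * exp (- x * (1 / pmf q t))) * indicator {0..} x \<partial>lborel)"
        using \<delta> by (intro nn_integral_cong)
          (auto simp: ennreal_mult'[symmetric] simp del: ennreal_plus split: split_indicator)
      also have "\<dots> = ennreal (pmf q t * (pmf q t + \<delta>))"
        using nn_integral_exp_decay(1)[of "1 / pmf q t" \<delta>] qt \<delta>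
        by (simp add: power_divide power2_eq_square distrib_left mult.commute)
      finally have "(\<integral>\<^sup>+y. ennreal (\<Theta> t y) \<partial>measure_pmf (\<kappa> t)) \<le> ennreal (pmf q t * (pmf q t + \<delta>)) / ennreal (pmf q t)"
        unfolding int\<kappa>[OF t] by (rule divide_right_mono_ennreal)
      also have "\<dots> = ennreal (pmf q t + \<delta>)"
        using qt \<delta> by (subst divide_ennreal) auto
      finally show ?thesis .
    qed
    ultimately show "\<exists>\<kappa>. bind_pmf q \<kappa> = \<nu> \<and>
      (\<forall>t\<in>set_pmf q. (\<integral>\<^sup>+y. ennreal (\<Theta> t y) \<partial>measure_pmf (\<kappa> t)) \<le> ennreal (pmf q t + \<delta>))" by blast
  qed
qed

section \<open>The strong functional representation\<close>

text \<open>Clock \<open>t\<close> is rescaled by the marginal \<open>P(t)\<close>; the decoder believes in \<open>t\<close> with weight proportional to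
  \<open>(\<theta> + b) powr (- \<epsilon> - 1)\<close>, where \<open>\<theta>\<close> is the rescaled clock.  When \<open>t\<close> wins for \<open>w\<close>, the mean of \<open>\<theta>\<close> is \<open>P(t | w) / P(t)\<close>,
  so Jensen's inequality gives \<open>E log (\<theta> + b) \<le> I(W; T) + log (1 + 2 b)\<close>, and \<open>\<epsilon>\<close> is optimised at the end.\<close>

lemma strong_functional_representation:
  fixes P :: "'o pmf" and W :: "'o \<Rightarrow> 'w" and T :: "'o \<Rightarrow> 't"
  defines "J \<equiv> map_pmf (\<lambda>\<omega>. (W \<omega>, T \<omega>)) P"
  assumes finT: "finite (set_pmf (map_pmf T P))"
  obtains K :: "'o \<Rightarrow> nat list pmf" and \<nu> where
    "obs P K W = pair_pmf \<nu> (map_pmf W P)"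
    "ent (map_pmf T P) - mut_info J - (log 2 (mut_info J + 5.51) + 1.06) \<le> mut_info (obs P K T)"
proof -
  define PT where "PT = map_pmf T P"
  define I where "I = set_pmf PT"
  have I: "finite I" using finT by (simp add: I_def PT_def)
  have J: "map_pmf fst J = map_pmf W P" "map_pmf snd J = PT"
    by (simp_all add: J_def PT_def map_pmf_comp)
  have fT: "finite_ent PT" using finT by (intro finite_ent_finite_support) (simp add: PT_def)
  have I0: "0 \<le> mut_info J" by (rule mut_info_nonneg) (simp add: J fT)
  \<comment> \<open>The rounding error \<delta> is divided by P(t) when clock t is rescaled, so it
    has to be small against the least marginal probability.\<close>
  define m where "m = Min (pmf PT ` I)"
  have m: "0 < m" "\<And>t. t \<in> I \<Longrightarrow> m \<le> pmf PT t"
    using I set_pmf_not_empty[of PT] by (auto simp: m_def I_def pmf_positive)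
  \<comment> \<open>The shift keeps the power integrable at 0. It costs log (1 + 2 b) once, half of
    it for rounding, and - log b = 5 per unit of \<epsilon>.\<close>
  define b :: real where "b = 1 / 32"
  define \<delta> where "\<delta> = m / 32"
  have \<delta>: "0 < \<delta>" using m by (simp add: \<delta>_def)
  obtain \<nu> :: "nat list pmf" and \<Theta> :: "'t \<Rightarrow> nat list \<Rightarrow> real" where
    \<Theta>0: "\<And>t y. 0 \<le> \<Theta> t y" and
    \<Theta>w: "\<And>t p b \<epsilon>. t \<in> I \<Longrightarrow> 0 < p \<Longrightarrow> 0 < b \<Longrightarrow> 0 < \<epsilon> \<Longrightarrow>
      (\<integral>\<^sup>+y. ennreal ((\<Theta> t y / p + b) powr (- \<epsilon> - 1)) \<partial>measure_pmf \<nu>) \<le> ennreal (p * b powr (- \<epsilon>) / \<epsilon>)" and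
    ex: "\<And>q. set_pmf q \<subseteq> I \<Longrightarrow> \<exists>\<kappa>. bind_pmf q \<kappa> = \<nu> \<and>
      (\<forall>t\<in>set_pmf q. (\<integral>\<^sup>+y. ennreal (\<Theta> t y) \<partial>measure_pmf (\<kappa> t)) \<le> ennreal (pmf q t + \<delta>))"
    by (rule exponential_race[OF I \<delta>]) (assumption | rule that)+
  have sub_I: "set_pmf (cond_snd J w) \<subseteq> I" if "w \<in> set_pmf (map_pmf W P)" for w
  proof
    fix t assume "t \<in> set_pmf (cond_snd J w)"
    then have "pmf J (w, t) \<noteq> 0" using that by (simp add: set_pmf_iff pmf_cond_snd J del: set_map_pmf)
    then have "t \<in> snd ` set_pmf J" by (force simp: set_pmf_iff)
    then show "t \<in> I" unfolding I_def J(2)[symmetric] by simp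
  qed
  have "\<forall>w\<in>set_pmf (map_pmf W P). \<exists>\<kappa>. bind_pmf (cond_snd J w) \<kappa> = \<nu> \<and>
      (\<forall>t\<in>set_pmf (cond_snd J w). (\<integral>\<^sup>+y. ennreal (\<Theta> t y) \<partial>measure_pmf (\<kappa> t)) \<le> ennreal (pmf (cond_snd J w) t + \<delta>))"
    by (intro ballI ex sub_I)
  from bchoice[OF this] obtain \<kappa> where \<kappa>: "\<And>w. w \<in> set_pmf (map_pmf W P) \<Longrightarrow> bind_pmf (cond_snd J w) (\<kappa> w) = \<nu>"
    "\<And>w t. w \<in> set_pmf (map_pmf W P) \<Longrightarrow> t \<in> set_pmf (cond_snd J w) \<Longrightarrow>
      (\<integral>\<^sup>+y. ennreal (\<Theta> t y) \<partial>measure_pmf (\<kappa> w t)) \<le> ennreal (pmf (cond_snd J w) t + \<delta>)"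
    by (auto simp del: set_map_pmf)
  define K where "K \<omega> = \<kappa> (W \<omega>) (T \<omega>)" for \<omega>
  have indep: "obs P K W = pair_pmf \<nu> (map_pmf W P)"
    unfolding K_def by (rule obs_indep) (use \<kappa>(1) J_def in simp)
  define N where "N = obs P K (\<lambda>\<omega>. \<omega>)"
  have NT: "map_pmf (\<lambda>n. (fst n, T (snd n))) N = obs P K T"
    using map_obs[of T P K "\<lambda>\<omega>. \<omega>"] by (simp add: N_def case_prod_unfold)
  have N_snd: "map_pmf snd N = P" by (simp add: N_def map_snd_obs)
  have NTs: "map_pmf (\<lambda>n. T (snd n)) N = PT"
    unfolding PT_def by (subst N_snd[symmetric]) (simp add: map_pmf_comp)
  have N_fst: "map_pmf fst N = \<nu>"
    using arg_cong[OF indep, of "map_pmf fst"] by (simp add: N_def map_fst_obs map_fst_pair_pmf)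
  define c where "c = log 2 (17 / 16 :: real)"
  \<comment> \<open>This is the total coefficient of - \<epsilon> in the final bound, with 5 = - log
    b.\<close>
  define A where "A = mut_info J + c + 5"
  have c: "0 \<le> c" "c \<le> 1 / 2"
  proof -
    have "2 * c = log 2 ((17 / 16) ^ 2)" unfolding c_def by (subst log_nat_power) simp_all
    also have "\<dots> \<le> log 2 2" by (subst log_le_cancel_iff) (simp_all add: power2_eq_square)
    finally show "c \<le> 1 / 2" by simp
    show "0 \<le> c" by (simp add: c_def)
  qed
  have A: "0 < A" using I0 c by (simp add: A_def)
  \<comment> \<open>The loss \<epsilon> A - log \<epsilon> is least at \<epsilon> = 1 / (A ln 2);
    3/2 is a rational close to 1 / ln 2.\<close>
  define \<epsilon> where "\<epsilon> = 3 / 2 / A"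
  have \<epsilon>: "0 < \<epsilon>" using A by (simp add: \<epsilon>_def)
  define Z where "Z = b powr (- \<epsilon>) / \<epsilon>"
  have Z: "0 < Z" using \<epsilon> by (simp add: Z_def b_def)
  have logZ: "log 2 Z = 5 * \<epsilon> - log 2 \<epsilon>"
  proof -
    have "b = 2 powr (- 5)" by (simp add: b_def powr_minus powr_numeral)
    then have "b powr (- \<epsilon>) = 2 powr (5 * \<epsilon>)" by (simp add: powr_powr)
    then show ?thesis using \<epsilon> by (simp add: Z_def log_divide)
  qed
  \<comment> \<open>The inverse likelihood ratio P(t) / P(t|w): minus its logarithm is the
    information density, and its mean is at most 1.\<close>
  define z where "z w t = pmf (map_pmf W P) w * pmf PT t / pmf J (w, t)" for w t
  define q where "q y t = (if t \<in> I then (\<Theta> t y / pmf PT t + b) powr (- \<epsilon> - 1) / Z else 0)" for y t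
  \<comment> \<open>Given \<omega>, the rescaled clock has mean about 1 / z, so multiplying by z
    normalises it: the mean of G is at most 1 + 1/16 = 17/16.\<close>
  define G where "G n = (\<Theta> (T (snd n)) (fst n) / pmf PT (T (snd n)) + b) * z (W (snd n)) (T (snd n))" for n
  \<comment> \<open>Jensen's inequality in pointwise form: the logarithm of G / (17/16) is replaced
    by its tangent at 1, which is integrable and has mean at most 0.\<close>
  define l where "l n = (- \<epsilon> - 1) * (pmi J (W (snd n), T (snd n)) + c + (G n / (17 / 16) - 1) / ln 2) - log 2 Z" for n
  have z0: "0 \<le> z w t" for w t by (simp add: z_def)
  have b0: "0 < b" by (simp add: b_def)
  have supp: "(W \<omega>, T \<omega>) \<in> set_pmf J" "T \<omega> \<in> I" "W \<omega> \<in> set_pmf (map_pmf W P)"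
    "0 < pmf J (W \<omega>, T \<omega>)" "0 < pmf PT (T \<omega>)" "0 < pmf (map_pmf W P) (W \<omega>)" "0 < z (W \<omega>) (T \<omega>)"
    if "\<omega> \<in> set_pmf P" for \<omega>
  proof -
    show 1: "(W \<omega>, T \<omega>) \<in> set_pmf J" "T \<omega> \<in> I" "W \<omega> \<in> set_pmf (map_pmf W P)"
      using that by (auto simp: J_def I_def PT_def)
    show 2: "0 < pmf J (W \<omega>, T \<omega>)" "0 < pmf PT (T \<omega>)" "0 < pmf (map_pmf W P) (W \<omega>)"
      using 1 unfolding I_def by (auto intro: pmf_positive simp del: set_map_pmf)
    show "0 < z (W \<omega>) (T \<omega>)" using 2 by (simp add: z_def)
  qed
  have iz: "integrable (measure_pmf P) (\<lambda>\<omega>. z (W \<omega>) (T \<omega>))"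
    "measure_pmf.expectation P (\<lambda>\<omega>. z (W \<omega>) (T \<omega>)) \<le> 1"
  proof -
    have "integrable (measure_pmf J) (\<lambda>x. z (fst x) (snd x))" "measure_pmf.expectation J (\<lambda>x. z (fst x) (snd x)) \<le> 1"
      using integrable_marginal_ratio[of J] by (simp_all add: z_def J)
    then show "integrable (measure_pmf P) (\<lambda>\<omega>. z (W \<omega>) (T \<omega>))"
      "measure_pmf.expectation P (\<lambda>\<omega>. z (W \<omega>) (T \<omega>)) \<le> 1"
      by (simp_all add: J_def)
  qed
  have inner: "(\<integral>\<^sup>+y. ennreal ((\<Theta> (T \<omega>) y / pmf PT (T \<omega>) + b) * z (W \<omega>) (T \<omega>)) \<partial>measure_pmf (K \<omega>))
      \<le> ennreal (1 + z (W \<omega>) (T \<omega>) / 16)" if \<omega>: "\<omega> \<in> set_pmf P" for \<omega>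
  proof -
    note s = supp[OF \<omega>]
    let ?p = "pmf PT (T \<omega>)" and ?z = "z (W \<omega>) (T \<omega>)" and ?C = "pmf (cond_snd J (W \<omega>)) (T \<omega>)"
    have C: "?C = pmf J (W \<omega>, T \<omega>) / pmf (map_pmf W P) (W \<omega>)"
      using pmf_cond_snd[of "W \<omega>" J] s(3) by (simp add: J del: set_map_pmf)
    then have "T \<omega> \<in> set_pmf (cond_snd J (W \<omega>))" using s by (simp add: set_pmf_iff)
    note k = \<kappa>(2)[OF s(3) this]
    have "(\<integral>\<^sup>+y. ennreal ((\<Theta> (T \<omega>) y / ?p + b) * ?z) \<partial>measure_pmf (K \<omega>))
        = (\<integral>\<^sup>+y. ennreal (?z / ?p) * ennreal (\<Theta> (T \<omega>) y) + ennreal (b * ?z) \<partial>measure_pmf (K \<omega>))"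
      using s \<Theta>0 b0 by (intro nn_integral_cong)
        (simp add: ennreal_mult'[symmetric] ennreal_plus[symmetric] algebra_simps del: ennreal_plus)
    also have "\<dots> = ennreal (?z / ?p) * (\<integral>\<^sup>+y. ennreal (\<Theta> (T \<omega>) y) \<partial>measure_pmf (K \<omega>)) + ennreal (b * ?z)"
      by (subst nn_integral_add) (simp_all add: nn_integral_cmult)
    also have "\<dots> \<le> ennreal (?z / ?p) * ennreal (?C + \<delta>) + ennreal (b * ?z)"
      using k by (intro add_right_mono mult_left_mono) (simp_all add: K_def)
    also have "\<dots> = ennreal (?z / ?p * (?C + \<delta>) + b * ?z)"
      using s b0 \<delta> by (simp add: ennreal_mult'[symmetric] ennreal_plus[symmetric] del: ennreal_plus)
    also have "?z / ?p * (?C + \<delta>) + b * ?z = 1 + (\<delta> / ?p + b) * ?z"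
    proof -
      have "?z / ?p * ?C = 1" using s by (simp add: C z_def)
      then show ?thesis by (auto simp: distrib_left distrib_right)
    qed
    also have "ennreal (1 + (\<delta> / ?p + b) * ?z) \<le> ennreal (1 + ?z / 16)"
    proof (rule ennreal_leI)
      have "\<delta> / ?p \<le> 1 / 32" using m(2)[OF s(2)] s by (simp add: \<delta>_def field_simps)
      then have "\<delta> / ?p + b \<le> 1 / 16" unfolding b_def by linarith
      then have "(\<delta> / ?p + b) * ?z \<le> (1 / 16) * ?z"
        using z0 by (rule mult_right_mono)
      then show "1 + (\<delta> / ?p + b) * ?z \<le> 1 + ?z / 16" by simp
    qed
    finally show ?thesis .
  qed
  have G0: "0 \<le> G n" for n using \<Theta>0 z0 b0 by (simp add: G_def)
  have "(\<integral>\<^sup>+n. ennreal (G n) \<partial>measure_pmf N)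
      = (\<integral>\<^sup>+\<omega>. (\<integral>\<^sup>+y. ennreal ((\<Theta> (T \<omega>) y / pmf PT (T \<omega>) + b) * z (W \<omega>) (T \<omega>)) \<partial>measure_pmf (K \<omega>)) \<partial>measure_pmf P)"
    by (simp add: N_def obs_def G_def)
  also have "\<dots> \<le> (\<integral>\<^sup>+\<omega>. ennreal (1 + z (W \<omega>) (T \<omega>) / 16) \<partial>measure_pmf P)"
    by (intro nn_integral_mono_AE) (simp add: AE_measure_pmf_iff inner)
  also have "\<dots> = ennreal (1 + measure_pmf.expectation P (\<lambda>\<omega>. z (W \<omega>) (T \<omega>)) / 16)"
    using iz z0 by (subst nn_integral_eq_integral) (auto simp del: ennreal_plus)
  also have "\<dots> \<le> ennreal (17 / 16)"
    using iz by (intro ennreal_leI) simp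
  finally have G: "(\<integral>\<^sup>+n. ennreal (G n) \<partial>measure_pmf N) \<le> ennreal (17 / 16)" .
  have iG: "integrable (measure_pmf N) G"
    by (rule integrableI_nonneg) (use G G0 in \<open>auto intro: le_less_trans\<close>)
  have EG: "measure_pmf.expectation N G \<le> 17 / 16"
    using G by (subst (asm) nn_integral_eq_integral[OF iG]) (auto simp: G0)
  have ipmi: "integrable (measure_pmf N) (\<lambda>n. pmi J (W (snd n), T (snd n)))"
    "measure_pmf.expectation N (\<lambda>n. pmi J (W (snd n), T (snd n))) = mut_info J"
  proof -
    have "integrable (measure_pmf J) (pmi J)" by (rule integrable_pmi) (simp add: J fT)
    then have "integrable (measure_pmf (map_pmf snd N)) (\<lambda>\<omega>. pmi J (W \<omega>, T \<omega>))"
      unfolding N_snd by (subst (asm) J_def) simp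
    then show "integrable (measure_pmf N) (\<lambda>n. pmi J (W (snd n), T (snd n)))" by simp
    have "mut_info J = measure_pmf.expectation P (\<lambda>\<omega>. pmi J (W \<omega>, T \<omega>))"
      unfolding mut_info_eq_expectation by (subst J_def) simp
    also have "\<dots> = measure_pmf.expectation N (\<lambda>n. pmi J (W (snd n), T (snd n)))"
      by (subst N_snd[symmetric]) simp
    finally show "measure_pmf.expectation N (\<lambda>n. pmi J (W (snd n), T (snd n))) = mut_info J" by simp
  qed
  have il: "integrable (measure_pmf N) l"
    unfolding l_def using ipmi iG by simp
  have "ent (map_pmf (\<lambda>n. T (snd n)) N) + measure_pmf.expectation N l
      \<le> mut_info (map_pmf (\<lambda>n. (fst n, T (snd n))) N)"
  proof (rule mut_info_ge_belief[OF _ _ _ _ il])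
    show "finite_ent (map_pmf (\<lambda>n. T (snd n)) N)" by (simp add: NTs fT)
    show "0 \<le> q y t" for y t using Z by (simp add: q_def)
    have "(\<integral>\<^sup>+y. (\<integral>\<^sup>+t. ennreal (q y t) \<partial>count_space UNIV) \<partial>measure_pmf (map_pmf fst N))
        = (\<integral>\<^sup>+y. (\<Sum>t\<in>I. ennreal (q y t)) \<partial>measure_pmf \<nu>)"
      unfolding N_fst using I by (intro nn_integral_cong nn_integral_count_space') (auto simp: q_def)
    also have "\<dots> = (\<Sum>t\<in>I. \<integral>\<^sup>+y. ennreal (q y t) \<partial>measure_pmf \<nu>)"
      by (rule nn_integral_sum) simp
    also have "\<dots> \<le> (\<Sum>t\<in>I. ennreal (pmf PT t))"
    proof (rule sum_mono)
      fix t assume t: "t \<in> I"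
      then have p: "0 < pmf PT t" by (auto simp: I_def intro: pmf_positive)
      have "(\<integral>\<^sup>+y. ennreal (q y t) \<partial>measure_pmf \<nu>)
          = (\<integral>\<^sup>+y. ennreal (1 / Z) * ennreal ((\<Theta> t y / pmf PT t + b) powr (- \<epsilon> - 1)) \<partial>measure_pmf \<nu>)"
        using Z t by (intro nn_integral_cong) (simp add: q_def ennreal_mult'[symmetric])
      also have "\<dots> = ennreal (1 / Z) * (\<integral>\<^sup>+y. ennreal ((\<Theta> t y / pmf PT t + b) powr (- \<epsilon> - 1)) \<partial>measure_pmf \<nu>)"
        by (rule nn_integral_cmult) simp
      also have "\<dots> \<le> ennreal (1 / Z) * ennreal (pmf PT t * b powr (- \<epsilon>) / \<epsilon>)"
        by (intro mult_left_mono \<Theta>w t p b0 \<epsilon>) simp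
      also have "\<dots> = ennreal (1 / Z * (pmf PT t * Z))"
        using \<epsilon> by (subst ennreal_mult'[symmetric]) (simp_all add: Z_def)
      also have "\<dots> = ennreal (pmf PT t)" using Z by simp
      finally show "(\<integral>\<^sup>+y. ennreal (q y t) \<partial>measure_pmf \<nu>) \<le> ennreal (pmf PT t)" .
    qed
    also have "\<dots> = 1"
      using sum_pmf_eq_1[OF I, of PT] by (subst sum_ennreal) (auto simp: I_def)
    finally show "(\<integral>\<^sup>+y. (\<integral>\<^sup>+t. ennreal (q y t) \<partial>count_space UNIV) \<partial>measure_pmf (map_pmf fst N)) \<le> 1" .
    fix n assume "n \<in> set_pmf N"
    then obtain y \<omega> where n: "n = (y, \<omega>)" "\<omega> \<in> set_pmf P"
      by (auto simp: N_def obs_def)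
    note s = supp[OF n(2)]
    let ?\<theta> = "\<Theta> (T \<omega>) y / pmf PT (T \<omega>) + b"
    have \<theta>: "0 < ?\<theta>" using \<Theta>0 s b0 by (intro add_nonneg_pos) simp_all
    then show "0 < q (fst n) (T (snd n))" using s Z by (simp add: n q_def)
    have Gn: "G n = ?\<theta> * z (W \<omega>) (T \<omega>)" by (simp add: n G_def)
    have "log 2 (G n / (17 / 16)) \<le> (G n / (17 / 16) - 1) / ln 2"
      using \<theta> s by (intro log2_le_minus_one) (simp add: Gn)
    moreover have "log 2 (G n / (17 / 16)) = log 2 ?\<theta> + log 2 (z (W \<omega>) (T \<omega>)) - c"
      using \<theta> s by (simp only: Gn c_def log_divide log_mult) (simp add: log_divide log_mult)
    moreover have "log 2 (z (W \<omega>) (T \<omega>)) = - pmi J (W \<omega>, T \<omega>)"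
      using pmi_split[OF s(1)] s by (simp add: z_def J log_divide log_mult)
    ultimately have "log 2 ?\<theta> \<le> pmi J (W \<omega>, T \<omega>) + c + (G n / (17 / 16) - 1) / ln 2" by linarith
    then have "(- \<epsilon> - 1) * (pmi J (W \<omega>, T \<omega>) + c + (G n / (17 / 16) - 1) / ln 2) \<le> (- \<epsilon> - 1) * log 2 ?\<theta>"
      using \<epsilon> by (intro mult_left_mono_neg) simp_all
    moreover have "log 2 (q y (T \<omega>)) = (- \<epsilon> - 1) * log 2 ?\<theta> - log 2 Z"
      using \<theta> s Z by (simp add: q_def log_divide log_powr)
    ultimately show "l n \<le> log 2 (q (fst n) (T (snd n)))"
      unfolding l_def by (simp add: n)
  qed
  then have main: "ent PT + measure_pmf.expectation N l \<le> mut_info (obs P K T)"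
    by (simp add: NT NTs)
  have "measure_pmf.expectation N l
      = (- \<epsilon> - 1) * (mut_info J + c + (measure_pmf.expectation N G / (17 / 16) - 1) / ln 2) - log 2 Z"
    unfolding l_def using ipmi iG by simp
  moreover have "(measure_pmf.expectation N G / (17 / 16) - 1) / ln 2 \<le> 0"
    using EG by (intro divide_nonpos_pos) auto
  then have "(- \<epsilon> - 1) * (mut_info J + c) \<le> (- \<epsilon> - 1) * (mut_info J + c + (measure_pmf.expectation N G / (17 / 16) - 1) / ln 2)"
    using \<epsilon> by (intro mult_left_mono_neg) simp_all
  ultimately have "(- \<epsilon> - 1) * (mut_info J + c) - (5 * \<epsilon> - log 2 \<epsilon>) \<le> measure_pmf.expectation N l"
    by (simp add: logZ)
  moreover have "(- \<epsilon> - 1) * (mut_info J + c) - (5 * \<epsilon> - log 2 \<epsilon>) = - mut_info J - c - \<epsilon> * A + log 2 \<epsilon>"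
    by (simp add: A_def algebra_simps)
  moreover have "\<epsilon> * A = 3 / 2" using A by (simp add: \<epsilon>_def)
  moreover have "log 2 \<epsilon> = log 2 (3 / 2) - log 2 A" using A by (simp add: \<epsilon>_def log_divide log_mult)
  moreover have "log 2 A \<le> log 2 (mut_info J + 5.51)"
    using A c I0 by (subst log_le_cancel_iff) (simp_all add: A_def)
  \<comment> \<open>The left side is log (17/24), and 0.44 = 11/25, so the claim becomes the
    rational comparison (17/24)^25 \<le> 2^(-11).\<close>
  moreover have "c - log 2 (3 / 2) \<le> - 0.44"
  proof -
    have "log 2 (17 / 16 / (3 / 2) :: real) = c - log 2 (3 / 2)"
      unfolding c_def by (subst log_divide) simp_all
    then have "25 * (c - log 2 (3 / 2)) = log 2 ((17 / 24) ^ 25)"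
      by (subst log_nat_power) simp_all
    also have "\<dots> \<le> log 2 (2 powr (- 11))"
      by (subst log_le_cancel_iff) (simp_all add: powr_minus powr_numeral power_divide divide_simps)
    finally show ?thesis by simp
  qed
  ultimately have "- mut_info J - (log 2 (mut_info J + 5.51) + 1.06) \<le> measure_pmf.expectation N l"
    by simp
  with main that[OF indep] show ?thesis by (simp add: PT_def)
qed

section \<open>Bounds on the optimal value\<close>

lemma ent_map_inj:
  assumes "inj_on f (set_pmf p)"
  shows "ent (map_pmf f p) = ent p"
  unfolding ent_map_eq_expectation
  by (subst ent_eq_expectation, rule integral_cong_AE) (auto simp: AE_measure_pmf_iff pmf_map_inj[OF assms])

lemma ent_map_le:
  assumes "finite_ent p"
  shows "ent (map_pmf f p) \<le> ent p"
  unfolding ent_map_eq_expectation unfolding ent_eq_expectation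
proof (rule integral_mono_AE)
  show "AE x in measure_pmf p. - log 2 (pmf (map_pmf f p) (f x)) \<le> - log 2 (pmf p x)"
    by (subst AE_measure_pmf_iff) (auto simp: pmf_map_ge pmf_positive)
qed (use assms finite_ent_map[OF assms, of f] in \<open>simp_all add: finite_ent_iff_integrable\<close>)

text \<open>Merging everything outside G into \<open>None\<close> keeps the terms of G intact, and
  the term of the merged atom is nonnegative. The race needs such a finite alphabet for T.\<close>

lemma ent_truncation:
  fixes p :: "'t pmf"
  assumes fin: "finite_ent p" and e: "0 < e"
  obtains G where "finite G" "ent p - e \<le> ent (map_pmf (\<lambda>t. if t \<in> G then Some t else None) p)"
proof -
  let ?f = "\<lambda>x. - pmf p x * log 2 (pmf p x)"
  have "(?f has_sum ent p) UNIV" using fin unfolding ent_def finite_ent_def by (rule has_sum_infsum)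
  from has_sum_finite_approximation[OF this e]
  obtain G where G: "finite G" "dist (sum ?f G) (ent p) \<le> e" by auto
  define p' where "p' = map_pmf (\<lambda>t. if t \<in> G then Some t else None) p"
  have p': "pmf p' (Some t) = pmf p t" if "t \<in> G" for t
  proof -
    have "(\<lambda>t. if t \<in> G then Some t else None) -` {Some t} = {t}" using that by (auto split: if_splits)
    then show ?thesis by (simp add: p'_def pmf_map measure_pmf_single)
  qed
  have "set_pmf p' \<subseteq> insert None (Some ` G)" by (auto simp: p'_def)
  then have "finite_ent p'" using G(1) by (intro finite_ent_finite_support) (auto dest: finite_subset)
  then have "(\<Sum>x\<in>Some ` G. - pmf p' x * log 2 (pmf p' x)) \<le> ent p'"
    unfolding ent_def finite_ent_def using G(1)
    by (intro finite_sum_le_infsum) (auto simp: mult_nonneg_nonpos log2_pmf_nonpos)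
  also have "(\<Sum>x\<in>Some ` G. - pmf p' x * log 2 (pmf p' x)) = sum ?f G"
    by (subst sum.reindex) (auto simp: p' intro!: sum.cong)
  finally show ?thesis using that[OF G(1)] G(2) by (simp add: p'_def dist_real_def)
qed

lemma mut_info_obs_indep:
  assumes "obs P K W = pair_pmf \<nu> (map_pmf W P)"
  shows "mut_info (obs P K (\<lambda>\<omega>. h (W \<omega>))) = 0"
proof -
  have "obs P K (\<lambda>\<omega>. h (W \<omega>)) = pair_pmf \<nu> (map_pmf h (map_pmf W P))"
    unfolding map_obs[symmetric] assms pair_map_pmf2 by (simp add: apsnd_def map_prod_def)
  then show ?thesis by (simp add: mut_info_pair_pmf)
qed

text \<open>Serves both directions: with T as the target it gives the first two upper bounds, and
  with X as the target and S as the side variable it shows that a representation independent of S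
  satisfies I(X;Y) \<le> H(X|S).\<close>

lemma mut_info_obs_le_add_cond_ent:
  assumes "finite_ent (map_pmf A P)" "finite_ent (map_pmf B P)"
  shows "mut_info (obs P K B) \<le> mut_info (obs P K A) + cond_ent (map_pmf (\<lambda>\<omega>. (B \<omega>, A \<omega>)) P)"
proof -
  let ?J = "obs P K (\<lambda>\<omega>. (A \<omega>, B \<omega>))"
  have snd: "map_pmf snd ?J = map_pmf (\<lambda>\<omega>. (A \<omega>, B \<omega>)) P" by (rule map_snd_obs)
  have "map_pmf (\<lambda>(y, a, b). a) ?J = map_pmf fst (map_pmf snd ?J)"
    "map_pmf (\<lambda>(y, a, b). b) ?J = map_pmf snd (map_pmf snd ?J)"
    "map_pmf (\<lambda>(y, a, b). (b, a)) ?J = map_pmf (\<lambda>(a, b). (b, a)) (map_pmf snd ?J)"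
    by (simp_all add: map_pmf_comp case_prod_unfold)
  then have m: "map_pmf (\<lambda>(y, a, b). a) ?J = map_pmf A P" "map_pmf (\<lambda>(y, a, b). b) ?J = map_pmf B P"
    "map_pmf (\<lambda>(y, a, b). (b, a)) ?J = map_pmf (\<lambda>\<omega>. (B \<omega>, A \<omega>)) P"
    by (simp_all add: snd map_pmf_comp)
  have o: "map_pmf (\<lambda>(y, a, b). (y, a)) ?J = obs P K A" "map_pmf (\<lambda>(y, a, b). (y, b)) ?J = obs P K B"
    using map_obs[of fst P K "\<lambda>\<omega>. (A \<omega>, B \<omega>)"] map_obs[of snd P K "\<lambda>\<omega>. (A \<omega>, B \<omega>)"]
    by (simp_all add: case_prod_unfold)
  show ?thesis using mut_info_le_add_cond_ent[of ?J] assms by (simp only: m o)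
qed

section \<open>Achievable pairs of constraint and value\<close>

definition achievable :: "('s \<times> 'x \<times> 't) pmf \<Rightarrow> real \<Rightarrow> real \<Rightarrow> bool" where
  "achievable P r v \<longleftrightarrow> (\<exists>K :: 's \<times> 'x \<times> 't \<Rightarrow> nat pmf.
    mut_info (obs P K (\<lambda>(s, x, t). s)) = 0 \<and> mut_info (obs P K (\<lambda>(s, x, t). x)) \<le> r \<and>
    v \<le> mut_info (obs P K (\<lambda>(s, x, t). t)))"

lemma achievableI:
  fixes P :: "('s \<times> 'x \<times> 't) pmf" and K :: "'s \<times> 'x \<times> 't \<Rightarrow> 'y pmf"
  assumes "mut_info (obs P K (\<lambda>(s, x, t). s)) = 0" "mut_info (obs P K (\<lambda>(s, x, t). x)) \<le> r"
    "v \<le> mut_info (obs P K (\<lambda>(s, x, t). t))"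
  shows "achievable P r v"
proof -
  obtain K' :: "'s \<times> 'x \<times> 't \<Rightarrow> nat pmf" where
    "\<And>f :: 's \<times> 'x \<times> 't \<Rightarrow> 's. mut_info (obs P K' f) = mut_info (obs P K f)"
    "\<And>f :: 's \<times> 'x \<times> 't \<Rightarrow> 'x. mut_info (obs P K' f) = mut_info (obs P K f)"
    "\<And>f :: 's \<times> 'x \<times> 't \<Rightarrow> 't. mut_info (obs P K' f) = mut_info (obs P K f)"
    by (rule mut_info_obs_nat[of P K], rule that)
  then show ?thesis using assms unfolding achievable_def by (intro exI[of _ K']) simp
qed

lemma achievable_mono: "achievable P r v \<Longrightarrow> r \<le> r' \<Longrightarrow> v' \<le> v \<Longrightarrow> achievable P r' v'"
  unfolding achievable_def by (meson order_trans)

lemma achievable_time_sharing: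
  fixes P :: "('s \<times> 'x \<times> 't) pmf"
  assumes fin: "finite_ent (map_pmf (\<lambda>(s, x, t). s) P)" "finite_ent (map_pmf (\<lambda>(s, x, t). x) P)"
    "finite_ent (map_pmf (\<lambda>(s, x, t). t) P)"
    and a1: "achievable P r1 v1" and a0: "achievable P r0 v0" and \<alpha>: "0 \<le> \<alpha>" "\<alpha> \<le> 1"
  shows "achievable P (\<alpha> * r1 + (1 - \<alpha>) * r0) (\<alpha> * v1 + (1 - \<alpha>) * v0)"
proof -
  obtain K1 K0 :: "'s \<times> 'x \<times> 't \<Rightarrow> nat pmf" where
    K1: "mut_info (obs P K1 (\<lambda>(s, x, t). s)) = 0" "mut_info (obs P K1 (\<lambda>(s, x, t). x)) \<le> r1"
      "v1 \<le> mut_info (obs P K1 (\<lambda>(s, x, t). t))" and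
    K0: "mut_info (obs P K0 (\<lambda>(s, x, t). s)) = 0" "mut_info (obs P K0 (\<lambda>(s, x, t). x)) \<le> r0"
      "v0 \<le> mut_info (obs P K0 (\<lambda>(s, x, t). t))"
    using a1 a0 unfolding achievable_def by blast
  define K where "K \<omega> = bind_pmf (bernoulli_pmf \<alpha>) (\<lambda>b. map_pmf (Pair b) (if b then K1 \<omega> else K0 \<omega>))" for \<omega>
  have mix: "mut_info (obs P K f) = \<alpha> * mut_info (obs P K1 f) + (1 - \<alpha>) * mut_info (obs P K0 f)"
    if "finite_ent (map_pmf f P)" for f :: "'s \<times> 'x \<times> 't \<Rightarrow> 'c"
  proof -
    have "obs P K f = bind_pmf (bernoulli_pmf \<alpha>) (\<lambda>b. map_pmf (\<lambda>(y, c). ((b, y), c)) (obs P (if b then K1 else K0) f))"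
      unfolding K_def using obs_mixture[of P "bernoulli_pmf \<alpha>" "\<lambda>b. if b then K1 else K0" f]
      by (simp add: if_distrib[where f = "\<lambda>g. g _"] cong: if_cong)
    then show ?thesis
      using mut_info_mixture[OF \<alpha>, of "\<lambda>b. obs P (if b then K1 else K0) f" "map_pmf f P"] that
      by (simp add: map_snd_obs)
  qed
  show ?thesis
  proof (rule achievableI)
    show "mut_info (obs P K (\<lambda>(s, x, t). s)) = 0" using K1 K0 by (simp add: mix fin)
    show "mut_info (obs P K (\<lambda>(s, x, t). x)) \<le> \<alpha> * r1 + (1 - \<alpha>) * r0"
      unfolding mix[OF fin(2)] using K1 K0 \<alpha> by (intro add_mono mult_left_mono) auto
    show "\<alpha> * v1 + (1 - \<alpha>) * v0 \<le> mut_info (obs P K (\<lambda>(s, x, t). t))"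
      unfolding mix[OF fin(3)] using K1 K0 \<alpha> by (intro add_mono mult_left_mono) auto
  qed
qed

lemma joint_Y_obs:
  "map_pmf (\<lambda>(s, x, t, y). (y, t)) (joint_Y P K) = obs P K (\<lambda>(s, x, t). t)"
  "map_pmf (\<lambda>(s, x, t, y). (y, s)) (joint_Y P K) = obs P K (\<lambda>(s, x, t). s)"
  "map_pmf (\<lambda>(s, x, t, y). (x, y)) (joint_Y P K) = map_pmf (\<lambda>(y, x). (x, y)) (obs P K (\<lambda>(s, x, t). x))"
  by (simp_all add: joint_Y_def obs_def map_bind_pmf map_pmf_comp case_prod_unfold)

lemma g0_eq_Sup_achievable_values:
  "g0 P r = Sup {mut_info (obs P K (\<lambda>(s, x, t). t)) | K :: _ \<Rightarrow> nat pmf. mut_info (obs P K (\<lambda>(s, x, t). s)) = 0 \<and>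
    mut_info (obs P K (\<lambda>(s, x, t). x)) \<le> r}"
  unfolding g0_def joint_Y_obs mut_info_swap ..

context
  fixes P :: "('s::finite \<times> 'x::countable \<times> 't::countable) pmf"
  assumes finX: "finite_ent (map_pmf (\<lambda>(s, x, t). x) P)" and finT: "finite_ent (map_pmf (\<lambda>(s, x, t). t) P)"
begin

lemma finite_ent_S: "finite_ent (map_pmf (\<lambda>(s, x, t). s) P)"
  by (rule finite_ent_finite_support) (rule finite)

lemma finite_ent_XS: "finite_ent (map_pmf (\<lambda>(s, x, t). (x, s)) P)"
  by (rule finite_ent_pair) (use finX finite_ent_S in \<open>simp_all add: map_pmf_comp case_prod_unfold\<close>)

lemma feasible_le_U0:
  assumes "mut_info (obs P K (\<lambda>(s, x, t). s)) = 0"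
  shows "mut_info (obs P K (\<lambda>(s, x, t). t)) \<le> U0 P"
proof -
  let ?O = "obs P K (\<lambda>(s, x, t). (s, t))"
  define J where "J = map_pmf (\<lambda>(y, s, t). (s, t, y)) ?O"
  have S: "map_pmf fst J = map_pmf fst P" and T: "map_pmf (\<lambda>(s, t, y). t) J = map_pmf (\<lambda>(s, x, t). t) P"
    and ST: "map_pmf (\<lambda>(s, t, y). (s, t)) J = map_pmf (\<lambda>(s, x, t). (s, t)) P"
    using arg_cong[OF map_snd_obs[of P K "\<lambda>(s, x, t). (s, t)"], of "map_pmf fst"]
      arg_cong[OF map_snd_obs[of P K "\<lambda>(s, x, t). (s, t)"], of "map_pmf snd"]
      map_snd_obs[of P K "\<lambda>(s, x, t). (s, t)"]
    by (simp_all add: J_def map_pmf_comp case_prod_unfold)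
  have YT: "map_pmf (\<lambda>(s, t, y). (y, t)) J = obs P K (\<lambda>(s, x, t). t)"
    using map_obs[of snd P K "\<lambda>(s, x, t). (s, t)"] by (simp add: J_def map_pmf_comp case_prod_unfold)
  have SY: "map_pmf (\<lambda>(s, t, y). (s, y)) J = map_pmf (\<lambda>(y, s). (s, y)) (obs P K (\<lambda>(s, x, t). s))"
  proof -
    have "map_pmf (\<lambda>(s, t, y). (s, y)) J = map_pmf (\<lambda>(y, s). (s, y)) (map_pmf (\<lambda>(y, c). (y, fst c)) ?O)"
      by (simp add: J_def map_pmf_comp case_prod_unfold)
    also have "map_pmf (\<lambda>(y, c). (y, fst c)) ?O = obs P K (\<lambda>(s, x, t). s)"
      unfolding map_obs by (simp add: case_prod_unfold)
    finally show ?thesis .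
  qed
  have "obs P K (\<lambda>(s, x, t). s) = pair_pmf (bind_pmf P K) (map_pmf (\<lambda>(s, x, t). s) P)"
    using mut_info_zero_imp_indep[OF _ assms] finite_ent_S by (simp add: map_snd_obs map_fst_obs)
  then have indep: "map_pmf (\<lambda>(s, t, y). (s, y)) J = pair_pmf (map_pmf fst J) (map_pmf (\<lambda>(s, t, y). y) J)"
  proof -
    assume *: "obs P K (\<lambda>(s, x, t). s) = pair_pmf (bind_pmf P K) (map_pmf (\<lambda>(s, x, t). s) P)"
    have "map_pmf (\<lambda>(s, t, y). y) J = bind_pmf P K"
      using map_fst_obs[of P K "\<lambda>(s, x, t). (s, t)"] by (simp add: J_def map_pmf_comp case_prod_unfold)
    moreover have "map_pmf (\<lambda>(s, x, t). s) P = map_pmf fst P" by (simp add: case_prod_unfold)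
    ultimately show ?thesis
      unfolding SY * S by (simp add: pair_commute_pmf[of "map_pmf fst P"])
  qed
  have "finite_ent (map_pmf (\<lambda>(s, t, y). t) J)" unfolding T by (rule finT)
  from mut_info_le_level_bound[OF this indep] show ?thesis
    unfolding YT S T ST U0_def condT_def .
qed

lemma feasible_le:
  assumes S: "mut_info (obs P K (\<lambda>(s, x, t). s)) = 0" and X: "mut_info (obs P K (\<lambda>(s, x, t). x)) \<le> r"
  shows "mut_info (obs P K (\<lambda>(s, x, t). t)) \<le> min (cond_ent (map_pmf (\<lambda>(s, x, t). (t, x)) P) + r)
    (min (cond_ent (map_pmf (\<lambda>(s, x, t). (t, s)) P)) (U0 P))"
  using mut_info_obs_le_add_cond_ent[OF finX finT, of K] mut_info_obs_le_add_cond_ent[OF finite_ent_S finT, of K]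
    feasible_le_U0[OF S] S X
  by (simp add: case_prod_unfold)

text \<open>The achievable value \<open>v\<close> only witnesses that some kernel is feasible: a
  bound on a supremum of reals requires a nonempty set.\<close>

lemma g0_le:
  assumes "achievable P r v"
  shows "g0 P r \<le> min (cond_ent (map_pmf (\<lambda>(s, x, t). (t, x)) P) + r)
    (min (cond_ent (map_pmf (\<lambda>(s, x, t). (t, s)) P)) (U0 P))"
  unfolding g0_eq_Sup_achievable_values
  by (rule cSup_least) (use assms feasible_le in \<open>auto simp: achievable_def\<close>)

text \<open>The feasible values are bounded above by \<open>U0\<close>, so the supremum dominates
  each of them; the slack \<open>e\<close> absorbs the truncation errors.\<close>

lemma g0_ge:
  assumes "\<And>e. 0 < e \<Longrightarrow> achievable P r (v - e)"
  shows "v \<le> g0 P r"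
proof (rule field_le_epsilon)
  fix e :: real assume "0 < e"
  from assms[OF this] obtain K :: "_ \<Rightarrow> nat pmf" where K: "mut_info (obs P K (\<lambda>(s, x, t). s)) = 0"
    "mut_info (obs P K (\<lambda>(s, x, t). x)) \<le> r" "v - e \<le> mut_info (obs P K (\<lambda>(s, x, t). t))"
    unfolding achievable_def by blast
  have "mut_info (obs P K (\<lambda>(s, x, t). t)) \<le> g0 P r"
    unfolding g0_eq_Sup_achievable_values
  proof (rule cSup_upper)
    show "bdd_above {mut_info (obs P K (\<lambda>(s, x, t). t)) | K :: _ \<Rightarrow> nat pmf. mut_info (obs P K (\<lambda>(s, x, t). s)) = 0 \<and>
        mut_info (obs P K (\<lambda>(s, x, t). x)) \<le> r}"
      by (rule bdd_aboveI[of _ "U0 P"]) (auto intro: feasible_le_U0)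
  qed (use K in blast)
  with K show "v \<le> g0 P r + e" by simp
qed

text \<open>The alphabet of S is finite, so the family can be indexed by all of it and no tail
  remains. The constraint holds because I(X;Y) \<le> I(S;Y) + H(X|S).\<close>

lemma achievable_functional_S:
  "achievable P (cond_ent (map_pmf (\<lambda>(s, x, t). (x, s)) P))
    (ent (map_pmf (\<lambda>(s, x, t). t) P) - ent (map_pmf (\<lambda>(s, x, t). s) P))"
proof -
  let ?S = "\<lambda>(s, x, t). s :: 's" and ?T = "\<lambda>(s, x, t). t :: 't"
  let ?J = "map_pmf (\<lambda>\<omega>. (?S \<omega>, ?T \<omega>)) P"
  obtain K :: "_ \<Rightarrow> ('s \<Rightarrow> 't) pmf" and \<nu> where K: "obs P K ?S = pair_pmf \<nu> (map_pmf ?S P)"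
    and v: "ent (map_pmf ?T P) - ent (map_pmf ?S P)
      + measure_pmf.expectation ?J (\<lambda>z. if fst z \<in> UNIV then 0 else log 2 (pmf ?J z)) \<le> mut_info (obs P K ?T)"
    by (rule functional_representation[OF finite_ent_S finT finite], rule that)
  have 0: "mut_info (obs P K (\<lambda>(s, x, t). s)) = 0" using K by (simp add: mut_info_pair_pmf)
  show ?thesis
  proof (rule achievableI[OF 0])
    show "mut_info (obs P K (\<lambda>(s, x, t). x)) \<le> cond_ent (map_pmf (\<lambda>(s, x, t). (x, s)) P)"
      using mut_info_obs_le_add_cond_ent[OF finite_ent_S finX, of K] 0 by (simp add: case_prod_unfold)
  qed (use v in simp)
qed

lemma achievable_zero:
  assumes K: "obs P K (\<lambda>(s, x, t). (x, s)) = pair_pmf \<nu> (map_pmf (\<lambda>(s, x, t). (x, s)) P)"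
    and v: "v \<le> mut_info (obs P K (\<lambda>(s, x, t). t))"
  shows "achievable P 0 v"
  using mut_info_obs_indep[OF K, of snd] mut_info_obs_indep[OF K, of fst] v
  by (intro achievableI[of P K]) (simp_all add: case_prod_unfold)

lemma achievable_functional_XS:
  assumes e: "0 < e"
  shows "achievable P 0 (ent (map_pmf (\<lambda>(s, x, t). t) P) - ent (map_pmf (\<lambda>(s, x, t). (x, s)) P) - e)"
proof -
  let ?W = "\<lambda>(s, x, t). (x, s) :: 'x \<times> 's" and ?T = "\<lambda>(s, x, t). t :: 't"
  let ?J = "map_pmf (\<lambda>\<omega>. (?W \<omega>, ?T \<omega>)) P"
  have "finite_ent ?J"
    by (rule finite_ent_pair) (use finite_ent_XS finT in \<open>simp_all add: map_pmf_comp case_prod_unfold\<close>)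
  then obtain F where F: "finite F"
    "- e \<le> measure_pmf.expectation ?J (\<lambda>z. if fst z \<in> F then 0 else log 2 (pmf ?J z))"
    using e by (rule finite_ent_tail)
  obtain K :: "_ \<Rightarrow> ('x \<times> 's \<Rightarrow> 't) pmf" and \<nu> where K: "obs P K ?W = pair_pmf \<nu> (map_pmf ?W P)"
    and v: "ent (map_pmf ?T P) - ent (map_pmf ?W P)
      + measure_pmf.expectation ?J (\<lambda>z. if fst z \<in> F then 0 else log 2 (pmf ?J z)) \<le> mut_info (obs P K ?T)"
    by (rule functional_representation[OF finite_ent_XS finT F(1)], rule that)
  show ?thesis by (rule achievable_zero[OF K]) (use F(2) v in linarith)
qed

text \<open>Truncating T to h(T) errs on the right side throughout: the penalty, increasing in the
  information with (X,S), does not grow, I(Y;h(T)) \<le> I(Y;T), and the entropy drops by at most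
  \<open>e\<close>.\<close>

lemma achievable_strong_functional_XS:
  assumes e: "0 < e"
  defines "I0 \<equiv> mut_info (map_pmf (\<lambda>(s, x, t). ((x, s), t)) P)"
  shows "achievable P 0 (ent (map_pmf (\<lambda>(s, x, t). t) P) - I0 - (log 2 (I0 + 5.51) + 1.06) - e)"
proof -
  let ?W = "\<lambda>(s, x, t). (x, s) :: 'x \<times> 's" and ?T = "\<lambda>(s, x, t). t :: 't"
  obtain G where G: "finite G"
    "ent (map_pmf ?T P) - e \<le> ent (map_pmf (\<lambda>t. if t \<in> G then Some t else None) (map_pmf ?T P))"
    using ent_truncation[OF finT e] .
  define h where "h t = (if t \<in> G then Some t else None)" for t :: 't
  let ?T' = "\<lambda>\<omega>. h (?T \<omega>)"
  have "set_pmf (map_pmf ?T' P) \<subseteq> insert None (Some ` G)" by (auto simp: h_def)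
  then have fT': "finite (set_pmf (map_pmf ?T' P))" using G(1) by (auto dest: finite_subset)
  define I' where "I' = mut_info (map_pmf (\<lambda>\<omega>. (?W \<omega>, ?T' \<omega>)) P)"
  obtain K :: "_ \<Rightarrow> nat list pmf" and \<nu> where K: "obs P K ?W = pair_pmf \<nu> (map_pmf ?W P)"
    and v: "ent (map_pmf ?T' P) - I' - (log 2 (I' + 5.51) + 1.06) \<le> mut_info (obs P K ?T')"
    by (rule strong_functional_representation[where W = ?W, OF fT', folded I'_def], rule that)
  have "I' = mut_info (map_pmf (\<lambda>(w, t). (w, h t)) (map_pmf (\<lambda>(s, x, t). ((x, s), t)) P))"
    by (simp add: I'_def map_pmf_comp case_prod_unfold)
  also have "\<dots> \<le> I0"
    unfolding I0_def by (rule mut_info_map_snd_le) (use finT in \<open>simp add: map_pmf_comp case_prod_unfold\<close>)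
  finally have I: "I' \<le> I0" .
  have I'0: "0 \<le> I'"
    unfolding I'_def by (rule mut_info_nonneg)
      (rule finite_ent_finite_support, use fT' in \<open>simp add: map_pmf_comp\<close>)
  have "log 2 (I' + 5.51) \<le> log 2 (I0 + 5.51)"
    using I I'0 by (subst log_le_cancel_iff) auto
  moreover have "mut_info (obs P K ?T') \<le> mut_info (obs P K ?T)"
    using mut_info_map_snd_le[of "obs P K ?T" h] finT by (simp add: map_snd_obs map_obs)
  moreover have "ent (map_pmf ?T P) - e \<le> ent (map_pmf ?T' P)"
    using G(2) by (simp add: map_pmf_comp h_def[abs_def])
  ultimately show ?thesis
    by (intro achievable_zero[OF K]) (use v I in linarith)
qed

end

text \<open>Concavity of the logarithm between I + c and M + c; the term at M + c is nonnegative
  because M + c \<ge> 1, and is dropped.\<close>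

lemma log_time_sharing:
  fixes I M c \<alpha> :: real
  assumes "0 \<le> I" "0 \<le> M" "1 \<le> c" "0 \<le> \<alpha>" "\<alpha> \<le> 1"
  shows "(1 - \<alpha>) * log 2 (I + c) \<le> log 2 ((1 - \<alpha>) * I + \<alpha> * M + c)"
proof -
  have "- log 2 ((1 - \<alpha>) * (I + c) + \<alpha> * (M + c))
      \<le> (1 - \<alpha>) * - log 2 (I + c) + \<alpha> * - log 2 (M + c)"
    using convex_onD[OF minus_log_convex[of 2], of \<alpha> "I + c" "M + c"] assms by simp
  moreover have "0 \<le> \<alpha> * log 2 (M + c)" using assms by simp
  moreover have "(1 - \<alpha>) * (I + c) + \<alpha> * (M + c) = (1 - \<alpha>) * I + \<alpha> * M + c"
    by (simp add: algebra_simps)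
  ultimately show ?thesis by simp
qed

theorem theorem1:
  fixes P :: "('s::finite \<times> 'x::countable \<times> 't::countable) pmf" and r :: real
  assumes "finite_ent (map_pmf (\<lambda>(s,x,t). x) P)"
      and "finite_ent (map_pmf (\<lambda>(s,x,t). t) P)"
  defines "HT \<equiv> ent (map_pmf (\<lambda>(s,x,t). t) P)"
      and "HX \<equiv> ent (map_pmf (\<lambda>(s,x,t). x) P)"
      and "HS \<equiv> ent (map_pmf (\<lambda>(s,x,t). s) P)"
      and "HXS \<equiv> ent (map_pmf (\<lambda>(s,x,t). (x,s)) P)"
      and "HX_S \<equiv> cond_ent (map_pmf (\<lambda>(s,x,t). (x,s)) P)"
      and "HT_X \<equiv> cond_ent (map_pmf (\<lambda>(s,x,t). (t,x)) P)"
      and "HT_S \<equiv> cond_ent (map_pmf (\<lambda>(s,x,t). (t,s)) P)"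
      and "HS_T \<equiv> cond_ent (map_pmf (\<lambda>(s,x,t). (s,t)) P)"
      and "HT_XS \<equiv> cond_ent (map_pmf (\<lambda>(s,x,t). (t,(x,s))) P)"
      and "HXS_T \<equiv> cond_ent (map_pmf (\<lambda>(s,x,t). ((x,s),t)) P)"
      and "IXST \<equiv> mut_info (map_pmf (\<lambda>(s,x,t). ((x,s),t)) P)"
  shows "(0 \<le> r \<and> r \<le> HX_S \<longrightarrow>
           (let \<alpha> = r / HX_S;
                L1 = HT_XS + r - HXS_T;
                L2 = HT_XS - (log 2 (IXST + 5.51) + 1.06);
                L3 = HT_XS + r - \<alpha> * HXS_T - 1.06
                     - log 2 ((1 - \<alpha>) * IXST + \<alpha> * min HT HXS + 5.51)
            in max L1 (max L2 L3) \<le> g0 P r \<and>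
               g0 P r \<le> min (HT_X + r) (min HT_S (U0 P))))
       \<and> (HX_S \<le> r \<and> r < HX \<longrightarrow>
           (let L1' = HT_S - HS_T;
                L2 = HT_XS - (log 2 (IXST + 5.51) + 1.06)
            in max L1' L2 \<le> g0 P r \<and>
               g0 P r \<le> min (HT_X + r) (min HT_S (U0 P))))"
proof -
  note finX = assms(1) and finT = assms(2)
  note finS = finite_ent_S[OF finX finT] and finXS = finite_ent_XS[OF finX finT]
  note upper = g0_le[OF finX finT, folded HT_X_def HT_S_def] and lower = g0_ge[OF finX finT]
  define H3 where "H3 = ent (map_pmf (\<lambda>(s,x,t). ((x,s),t)) P)"
  define HST where "HST = ent (map_pmf (\<lambda>(s,x,t). (s,t)) P)"
  have H3': "ent (map_pmf (\<lambda>(s,x,t). (t,(x,s))) P) = H3"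
    using ent_map_inj[of prod.swap "map_pmf (\<lambda>(s,x,t). ((x,s),t)) P"]
    by (simp add: H3_def map_pmf_comp case_prod_unfold prod.swap_def)
  have HST': "ent (map_pmf (\<lambda>(s,x,t). (t,s)) P) = HST"
    using ent_map_inj[of prod.swap "map_pmf (\<lambda>(s,x,t). (s,t)) P"]
    by (simp add: HST_def map_pmf_comp case_prod_unfold prod.swap_def)
  have HX_S: "HX_S = HXS - HS" and HT_XS: "HT_XS = H3 - HXS" and HXS_T: "HXS_T = H3 - HT"
    and HT_S: "HT_S = HST - HS" and HS_T: "HS_T = HST - HT"
    unfolding HX_S_def HT_XS_def HXS_T_def HT_S_def HS_T_def cond_ent_def H3' HST' HXS_def HS_def HT_def H3_def HST_def
    by (simp_all add: map_pmf_comp case_prod_unfold)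
  have IXST: "IXST = HXS + HT - H3"
    unfolding IXST_def H3_def HXS_def HT_def
    by (subst mut_info_eq_ent) (use finXS finT in \<open>simp_all add: map_pmf_comp case_prod_unfold\<close>)
  have I0: "0 \<le> IXST"
    unfolding IXST_def by (rule mut_info_nonneg) (use finT in \<open>simp add: map_pmf_comp case_prod_unfold\<close>)
  have M0: "0 \<le> min HT HXS" by (simp add: HT_def HXS_def ent_nonneg)
  note A1 = achievable_functional_S[OF finX finT, folded HX_S_def HT_def HS_def]
  note A2 = achievable_functional_XS[OF finX finT, folded HT_def HXS_def]
  note A3 = achievable_strong_functional_XS[OF finX finT, folded HT_def IXST_def]
  note share = achievable_time_sharing[OF finS finX finT]
  define L2 where "L2 = HT_XS - (log 2 (IXST + 5.51) + 1.06)"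
  have L2: "L2 \<le> g0 P r" if "0 \<le> r" for r
  proof (rule lower)
    fix e :: real assume "0 < e"
    from A3[OF this] show "achievable P r (L2 - e)"
      by (rule achievable_mono) (use that in \<open>simp_all add: L2_def IXST HT_XS\<close>)
  qed
  have "max (HT_XS + r - HXS_T) (max L2 (HT_XS + r - r / HX_S * HXS_T - 1.06
          - log 2 ((1 - r / HX_S) * IXST + r / HX_S * min HT HXS + 5.51))) \<le> g0 P r \<and>
      g0 P r \<le> min (HT_X + r) (min HT_S (U0 P))" if r: "0 \<le> r" "r \<le> HX_S"
  proof -
    define \<alpha> where "\<alpha> = r / HX_S"
    \<comment> \<open>If H(X|S) = 0 then r = 0 as well, and division by zero gives \<alpha> = 0, so
      the product is still r.\<close>
    have \<alpha>: "0 \<le> \<alpha>" "\<alpha> \<le> 1" "\<alpha> * HX_S = r"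
      using r by (auto simp: \<alpha>_def divide_le_eq_1)
    have L1: "HT_XS + r - HXS_T \<le> g0 P r"
    proof (rule lower)
      fix e :: real assume e: "0 < e"
      have "\<alpha> * (HT - HS) + (1 - \<alpha>) * (HT - HXS - e) = HT - HXS + \<alpha> * HX_S - (1 - \<alpha>) * e"
        by (simp add: HX_S algebra_simps)
      moreover have "(1 - \<alpha>) * e \<le> e" using \<alpha> e by (simp add: mult_left_le_one_le)
      ultimately show "achievable P r (HT_XS + r - HXS_T - e)"
        using achievable_mono[OF share[OF A1 A2[OF e] \<alpha>(1,2)], of r] \<alpha>(3) by (simp add: HT_XS HXS_T)
    qed
    have L3: "HT_XS + r - \<alpha> * HXS_T - 1.06 - log 2 ((1 - \<alpha>) * IXST + \<alpha> * min HT HXS + 5.51) \<le> g0 P r"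
    proof (rule lower)
      fix e :: real assume e: "0 < e"
      let ?v = "HT - IXST - (log 2 (IXST + 5.51) + 1.06) - e"
      \<comment> \<open>The logarithm and the constant 1.06 are abstracted to l and k so that the
        identity is purely polynomial.\<close>
      have eq: "\<alpha> * (HT - HS) + (1 - \<alpha>) * (HT - IXST - (l + k) - e)
          = HT_XS + \<alpha> * HX_S - \<alpha> * HXS_T - (1 - \<alpha>) * k - (1 - \<alpha>) * l - (1 - \<alpha>) * e" for l k
        by (simp add: HX_S HT_XS HXS_T IXST algebra_simps)
      have "(1 - \<alpha>) * e \<le> e" "(1 - \<alpha>) * 1.06 \<le> 1.06"
        using \<alpha> e by (simp_all add: mult_left_le_one_le)
      then have "HT_XS + r - \<alpha> * HXS_T - 1.06 - log 2 ((1 - \<alpha>) * IXST + \<alpha> * min HT HXS + 5.51) - e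
          \<le> \<alpha> * (HT - HS) + (1 - \<alpha>) * ?v"
        unfolding eq \<alpha>(3)
        by (intro diff_mono order.refl log_time_sharing[OF I0 M0 _ \<alpha>(1,2)]) simp_all
      then show "achievable P r (HT_XS + r - \<alpha> * HXS_T - 1.06 - log 2 ((1 - \<alpha>) * IXST + \<alpha> * min HT HXS + 5.51) - e)"
        using achievable_mono[OF share[OF A1 A3[OF e] \<alpha>(1,2)], of r] \<alpha>(3) by simp
    qed
    \<comment> \<open>Any achievable value would do here: it supplies the feasible kernel that the
      upper bound asks for.\<close>
    have "achievable P r (HT - HXS - 1)"
      using A2[of 1] by (rule achievable_mono) (use r in simp_all)
    from upper[OF this] L1 L2[OF r(1)] L3 show ?thesis by (simp add: \<alpha>_def)
  qed
  moreover have "max (HT_S - HS_T) L2 \<le> g0 P r \<and> g0 P r \<le> min (HT_X + r) (min HT_S (U0 P))"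
    if r: "HX_S \<le> r"
  proof -
    \<comment> \<open>Part (b) does not state r \<ge> 0; it follows from r \<ge> H(X|S) = H(X,S) -
      H(S) \<ge> 0.\<close>
    have "HS \<le> HXS"
      using ent_map_le[OF finXS, of snd] by (simp add: HS_def HXS_def map_pmf_comp case_prod_unfold)
    then have "0 \<le> r" using r by (simp add: HX_S)
    have a: "achievable P r (HT - HS)" using A1 by (rule achievable_mono) (use r in simp_all)
    have "HT_S - HS_T \<le> g0 P r"
    proof (rule lower)
      fix e :: real assume "0 < e"
      then show "achievable P r (HT_S - HS_T - e)"
        by (intro achievable_mono[OF a]) (simp_all add: HT_S HS_T)
    qed
    with upper[OF a] L2[OF \<open>0 \<le> r\<close>] show ?thesis by simp
  qed
  ultimately show ?thesis by (auto simp: Let_def L2_def)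
qed

end
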